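(* Let $\{x^k\}_{k\ge0}$ be a monotone randomized algorithm (MRA) with data $(S,g,h,c_1,c_2,c_3,\{\alpha_k\})$, suppose the stepsize condition holds with bound $\bar\alpha$, and suppose the global unified error bound (GUEB) holds with modulus $\phi_S:[0,\tau)\to\mathbb R_+$. Assume that $1/\phi_S$ is not integrable near $0$. Denote $\mathfrak h:=\frac{1-\log 2}{2}$ and $A_k:=\sum_{i=0}^{k-1}\alpha_i$. (i) For all $k\ge1$, $$\mathbb E[h(x^k)-h^*]\le \exp\Big(-\mathfrak h\frac{c_2}{c_3\bar\alpha}A_k\Big)(h(x^0)-h^* )+\Psi_S^{-1}\Big(\Psi_S(h(x^0)-h^* )+\frac{c_1c_2}{2}A_k\Big).$$ Suppose additionally that $1/\sqrt{\phi_S}$ is integrable near $0$. Then there exists a random variable $x^*$ such that $x^k$ converges to $x^*$ both almost surely and in $L^1$, that $x^*\in\arg\min_{x\in S}h(x)$ almost surely, and that $$\mathbb E[\|x^k-x^*\|]\le\frac{\sqrt{c_3}}{c_1c_2}\,\Phi_S\big(\mathbb E[h(x^k)-h^*]\big)\qquad\forall k\ge0.$$ (ii) There exists an almost surely finite random index $K_2$ such that, almost surely, $$h(x^k)-h^*\le\Psi_S^{-1}\Big(\frac{c_1c_2}{2}A_k\Big)\qquad\forall k\ge K_2.$$ Suppose additionally that $1/\sqrt{\phi_S}$ is integrable near $0$. Then, for the limit $x^*$ of part (i), there exists an almost surely finite random index $K_3$ such that, almost surely, $$\|x^k-x^*\|\le\frac{\sqrt2}{c_1\sqrt{c_2}}\,\Phi_S\Big(\Psi_S^{-1}\Big(\frac{c_1c_2}{2}A_k\Big)\Big)\qquad\forall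 k\ge K_3.$$
   Context: MRA. $(\Omega,\mathcal F,\{\mathcal F_k\}_{k\ge0},\mathbb P)$ is a filtered probability space and $\{x^k\}_{k\ge0}$ is a sequence of random vectors in $\mathbb R^d$ adapted to $\{\mathcal F_k\}$, with deterministic $x^0$. It is a monotone randomized algorithm (MRA) if there are a closed set $S\subseteq\mathbb R^d$, continuous functions $g,h:S\to\mathbb R$ with $g\ge0$ and $h^*:=\inf_{x\in S}h(x)>-\infty$, constants $c_1,c_2,c_3>0$ with $c_3\ge c_2$, and a positive (deterministic) sequence $\{\alpha_k\}_{k\ge0}$ such that for all $k\ge0$: $x^k\in S$; $h(x^{k+1})\le h(x^k)-\frac{c_1}{\alpha_k}\|x^{k+1}-x^k\|^2$; $\mathbb E[\|x^{k+1}-x^k\|^2\mid\mathcal F_k]\ge c_2\alpha_k^2g(x^k)$ almost surely; $\|x^{k+1}-x^k\|^2\le c_3\alpha_k^2g(x^k)$. Stepsize condition. There is $\bar\alpha>0$ with $0<\alpha_k\le\bar\alpha$ for all $k$, and $\sum_{k=0}^\infty\alpha_k=+\infty$. GUEB. There is a function $\phi_S:[0,\tau)\to\mathbb R_+$, $\tau\in(0,+\infty]$, such that $\phi_S(h(x)-h^* )\le g(x)$ for all $x\in S$; $\phi_S$ is non-decreasing and strictly positive on $(0,\tau)$ with $\phi_S(0)=0$; and $0\le h(x)-h^*<\tau$ for all $x\in S$. Notation. A function $[0,\tau)\to[0,+\infty]$ is integrable near $0$ if it is integrable on $[0,\tau']$ for some $\tau'\in(0,\tau)$. Fix any $t_0\in(0,\tau)$;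 $\Psi_S(t):=\int_t^{t_0}\frac{ds}{\phi_S(s)}$ for $t\in[0,\tau)$ (values in $\mathbb R\cup\{+\infty\}$), and, if $1/\sqrt{\phi_S}$ is integrable near $0$, $\Phi_S(t):=\int_0^t\frac{ds}{\sqrt{\phi_S(s)}}$. $\Psi_S$ is strictly decreasing; when $1/\phi_S$ is not integrable near $0$, $\Psi_S(0)=+\infty$ and the inverse $\Psi_S^{-1}$ is defined on $(\lim_{t\uparrow\tau}\Psi_S(t),+\infty]$, with $\Psi_S^{-1}(+\infty)=0$. *)

theory Defs
  imports "HOL-Probability.Probability"
begin

text \<open>
  Only the conditional expectation bound is an almost-sure statement; the other conditions
  hold at every sample point. The functions \<open>g\<close> and \<open>h\<close> are total, but only their values
  on \<open>S\<close> are constrained. The parameter \<open>x0\<close> is the deterministic value of \<open>x 0\<close>.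
\<close>

locale monotone_randomized_algorithm =
  prob_space M + filtration "space M" F
  for M :: "'a measure" and F :: "nat \<Rightarrow> 'a measure" +
  fixes x :: "nat \<Rightarrow> 'a \<Rightarrow> real ^ 'd" and x0 :: "real ^ 'd"
    and S :: "(real ^ 'd) set" and g h :: "real ^ 'd \<Rightarrow> real"
    and c1 c2 c3 :: real and \<alpha> :: "nat \<Rightarrow> real"
  assumes subalgebra_F: "\<And>k. subalgebra M (F k)"
    and adapted: "\<And>k. x k \<in> borel_measurable (F k)"
    and deterministic_start: "\<And>\<omega>. \<omega> \<in> space M \<Longrightarrow> x 0 \<omega> = x0"
    and closed_S: "closed S"
    and continuous_g: "continuous_on S g"
    and continuous_h: "continuous_on S h"
    and g_nonneg: "\<And>y. y \<in> S \<Longrightarrow> 0 \<le> g y"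
    and h_bdd_below: "bdd_below (h ` S)"
    and c1_pos: "0 < c1" and c2_pos: "0 < c2" and c3_pos: "0 < c3" and c2_le_c3: "c2 \<le> c3"
    and \<alpha>_pos: "\<And>k. 0 < \<alpha> k"
    and in_S: "\<And>k \<omega>. \<omega> \<in> space M \<Longrightarrow> x k \<omega> \<in> S"
    and sufficient_decrease: "\<And>k \<omega>. \<omega> \<in> space M \<Longrightarrow>
      h (x (Suc k) \<omega>) \<le> h (x k \<omega>) - c1 / \<alpha> k * (norm (x (Suc k) \<omega> - x k \<omega>))\<^sup>2"
    and expected_step_lower: "\<And>k. AE \<omega> in M.
      real_cond_exp M (F k) (\<lambda>\<omega>. (norm (x (Suc k) \<omega> - x k \<omega>))\<^sup>2) \<omega> \<ge> c2 * (\<alpha> k)\<^sup>2 * g (x k \<omega>)"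
    and step_upper: "\<And>k \<omega>. \<omega> \<in> space M \<Longrightarrow>
      (norm (x (Suc k) \<omega> - x k \<omega>))\<^sup>2 \<le> c3 * (\<alpha> k)\<^sup>2 * g (x k \<omega>)"

definition stepsize_condition :: "(nat \<Rightarrow> real) \<Rightarrow> real \<Rightarrow> bool" where
  "stepsize_condition \<alpha> abar \<longleftrightarrow>
     0 < abar \<and> (\<forall>k. 0 < \<alpha> k \<and> \<alpha> k \<le> abar) \<and>
     filterlim (\<lambda>n. \<Sum>k<n. \<alpha> k) at_top sequentially"

definition modulus_domain :: "ereal \<Rightarrow> real set" where
  "modulus_domain \<tau> = {t. 0 \<le> t \<and> ereal t < \<tau>}"

definition global_unified_error_bound ::
  "(real ^ 'd) set \<Rightarrow> (real ^ 'd \<Rightarrow> real) \<Rightarrow> (real ^ 'd \<Rightarrow> real) \<Rightarrow> ereal \<Rightarrow> (real \<Rightarrow> real) \<Rightarrow> bool" where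
  "global_unified_error_bound S g h \<tau> \<phi> \<longleftrightarrow>
     0 < \<tau> \<and>
     (\<forall>t\<in>modulus_domain \<tau>. 0 \<le> \<phi> t) \<and>
     mono_on (modulus_domain \<tau>) \<phi> \<and>
     (\<forall>t\<in>modulus_domain \<tau>. 0 < t \<longrightarrow> 0 < \<phi> t) \<and>
     \<phi> 0 = 0 \<and>
     (\<forall>y\<in>S. h y - (INF z\<in>S. h z) \<in> modulus_domain \<tau>) \<and>
     (\<forall>y\<in>S. \<phi> (h y - (INF z\<in>S. h z)) \<le> g y)"

text \<open>
  The functions integrated below are \<open>1/\<phi>\<close> and \<open>1/sqrt \<phi>\<close>. Mathematically they are \<open>+\<infinity>\<close>
  at \<open>0\<close> and finite elsewhere; here their value at \<open>0\<close> is \<open>1/0 = 0\<close>, which changes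
  neither integrability nor integrals because it affects a single point.
\<close>

definition integrable_near_0 :: "ereal \<Rightarrow> (real \<Rightarrow> real) \<Rightarrow> bool" where
  "integrable_near_0 \<tau> f \<longleftrightarrow> (\<exists>\<tau>'>0. ereal \<tau>' < \<tau> \<and> set_integrable lborel {0..\<tau>'} f)"

text \<open>The integral of \<open>1/\<phi>\<close> from \<open>t\<close> to \<open>t0\<close>, oriented and possibly \<open>+\<infinity>\<close> (at \<open>t = 0\<close>).\<close>

definition Psi :: "(real \<Rightarrow> real) \<Rightarrow> real \<Rightarrow> real \<Rightarrow> ereal" where
  "Psi \<phi> t0 t =
     (if t \<le> t0 then enn2ereal (\<integral>\<^sup>+s\<in>{t..t0}. ennreal (1 / \<phi> s) \<partial>lborel)
      else - enn2ereal (\<integral>\<^sup>+s\<in>{t0..t}. ennreal (1 / \<phi> s) \<partial>lborel))"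

text \<open>
  Meaningful at \<open>u\<close> in the range of \<open>Psi\<close> on the modulus domain. If \<open>1/\<phi>\<close> is not integrable
  near \<open>0\<close> then \<open>0\<close> is the only point where \<open>Psi\<close> is infinite, so \<open>Psi_inv\<close> is \<open>0\<close> at \<open>\<infinity>\<close>.
\<close>

definition Psi_inv :: "ereal \<Rightarrow> (real \<Rightarrow> real) \<Rightarrow> real \<Rightarrow> ereal \<Rightarrow> real" where
  "Psi_inv \<tau> \<phi> t0 u = the_inv_into (modulus_domain \<tau>) (Psi \<phi> t0) u"

definition Phi :: "(real \<Rightarrow> real) \<Rightarrow> real \<Rightarrow> real" where
  "Phi \<phi> t = (LBINT s:{0..t}. 1 / sqrt (\<phi> s))"

definition converges_in_L1 :: "'a measure \<Rightarrow> (nat \<Rightarrow> 'a \<Rightarrow> real ^ 'd) \<Rightarrow> ('a \<Rightarrow> real ^ 'd) \<Rightarrow> bool" where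
  "converges_in_L1 M X Y \<longleftrightarrow>
     (\<forall>k. integrable M (X k)) \<and> integrable M Y \<and>
     (\<lambda>k. \<integral>\<omega>. norm (X k \<omega> - Y \<omega>) \<partial>M) \<longlonglongrightarrow> 0"

end

theory Submission
  imports Defs
begin

text \<open>
  Let \<open>D k \<in> [0,1]\<close> be the squared step divided by its upper bound; its conditional mean is at
  least \<open>c2 / c3\<close>. On every path \<open>Psi\<close> of the optimality gap grows by at least
  \<open>c1 * c3 * \<alpha> k * D k\<close> in step \<open>k\<close>, so both rates reduce to lower bounds for the sums
  \<open>W k = (\<Sum>i<k. \<alpha> i * D i)\<close>. These follow from an exponential moment bound, Chernoff-style for the
  expectation. Summing the exponential moments with weights \<open>\<alpha> k\<close> replaces a maximal inequality
  in the almost sure statement. When \<open>Phi\<close> exists, the expected step lengths are dominated by the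
  decrements of the expectation of the concave function \<open>Phi\<close> of the gap, and summing them
  yields convergence of the iterates.
\<close>

subsection \<open>The functions \<open>Psi\<close> and \<open>Phi\<close>\<close>

text \<open>The lower bound on the steps holds only in conditional mean: a single step may vanish
  while \<open>g\<close> is positive, so no path has a guaranteed decrease of order
  \<open>\<alpha> k\<close> per step. Asking \<open>W k\<close> to reach only half of
  \<open>c2 / c3 * A k\<close>, the lower bound for its mean, leaves room for concentration and is
  the origin of the \<open>1 / 2\<close> in the rate \<open>c1 * c2 / 2\<close>. For the almost sure
  claims, tail bounds of order \<open>exp (- \<delta> * A k)\<close> are not enough by themselves:
  \<open>A k\<close> may grow as slowly as a small multiple of a logarithm, or slower, so they need
  not be summable over \<open>k\<close> and the Borel-Cantelli lemma does not apply directly. With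
  the weights the sum is bounded however slowly \<open>A k\<close> grows. For the iterates the
  obstacle is that sufficient decrease controls squared steps, while convergence needs the steps
  themselves; the upper bound by \<open>sqrt g\<close> and the conditional lower bound bridge this
  in mean, and the known rate of the gap replaces them along a path. Since \<open>\<phi>\<close> is
  only monotone, nothing is differentiated: integrals are compared with their integrands at end
  points.\<close>

lemma antimono_set_integrable:
  fixes f :: "real \<Rightarrow> real"
  assumes f: "\<And>s t. a \<le> s \<Longrightarrow> s \<le> t \<Longrightarrow> t \<le> b \<Longrightarrow> f t \<le> f s"
  shows "set_integrable lborel {a..b} f"
proof (cases "a \<le> b")
  case True
  \<comment> \<open>No measurability of \<open>f\<close> is assumed. Clamping the argument to
    \<open>{a..b}\<close> extends \<open>f\<close> to an antitone function on the whole line, and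
    monotone functions are Borel.\<close>
  let ?g = "\<lambda>s. f (max a (min b s))"
  have "mono (\<lambda>s. - ?g s)"
    using True by (intro monoI) (auto intro!: f)
  then have "(\<lambda>s. - (- ?g s)) \<in> borel_measurable borel"
    by (intro borel_measurable_uminus borel_measurable_mono)
  then have meas: "?g \<in> borel_measurable lborel"
    by simp
  have "\<bar>f s\<bar> \<le> max \<bar>f a\<bar> \<bar>f b\<bar>" if "s \<in> {a..b}" for s
    using f[of a s] f[of s b] that by auto
  then have "AE s in lborel. s \<in> {a..b} \<longrightarrow> norm (?g s) \<le> max \<bar>f a\<bar> \<bar>f b\<bar>"
    by (intro AE_I2) auto
  then have "set_integrable lborel {a..b} ?g"
    unfolding set_integrable_def using meas
    by (intro integrableI_bounded_set_indicator) (auto simp: emeasure_lborel_Icc[OF True])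
  then show ?thesis
    by (rule iffD1[OF set_integrable_cong, rotated -1]) auto
qed (simp add: set_integrable_def)

lemma antimono_integral_bounds:
  fixes f :: "real \<Rightarrow> real"
  assumes f: "\<And>s t. a \<le> s \<Longrightarrow> s \<le> t \<Longrightarrow> t \<le> b \<Longrightarrow> f t \<le> f s" and ab: "a \<le> b"
  shows "(b - a) * f b \<le> integral {a..b} f" "integral {a..b} f \<le> (b - a) * f a"
proof -
  have i: "f integrable_on {a..b}"
    using antimono_set_integrable[of a b f] f set_borel_integral_eq_integral(1) by blast
  have "integral {a..b} (\<lambda>_. f b) \<le> integral {a..b} f"
    using f by (intro integral_le i) auto
  then show "(b - a) * f b \<le> integral {a..b} f"
    using ab by simp
  have "integral {a..b} f \<le> integral {a..b} (\<lambda>_. f a)"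
    using f by (intro integral_le i) auto
  then show "integral {a..b} f \<le> (b - a) * f a"
    using ab by simp
qed

lemma ennreal_eq_top_of_ge:
  assumes "\<And>B. ennreal B \<le> x"
  shows "x = \<infinity>"
proof (cases x)
  case (real r)
  have "ennreal (r + 1) \<le> ennreal r"
    using assms[of "r + 1"] real by simp
  then show ?thesis
    using real by simp
qed simp

lemma indicator_le_mono: "A \<subseteq> B \<Longrightarrow> (indicator A s :: ennreal) \<le> indicator B s"
  by (auto simp: indicator_def)

section \<open>Integrals of \<open>1 / \<phi>\<close> and inversion of \<open>Psi\<close>\<close>

locale error_bound_modulus =
  fixes \<tau> :: ereal and \<phi> :: "real \<Rightarrow> real" and t0 :: real
  assumes \<phi>_mono: "mono_on (modulus_domain \<tau>) \<phi>"
    and \<phi>_pos: "\<And>t. t \<in> modulus_domain \<tau> \<Longrightarrow> 0 < t \<Longrightarrow> 0 < \<phi> t"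
    and \<phi>_0: "\<phi> 0 = 0"
    and t0_pos: "0 < t0" and t0_less: "ereal t0 < \<tau>"
    and inverse_not_integrable: "\<not> integrable_near_0 \<tau> (\<lambda>s. 1 / \<phi> s)"
begin

lemma less_\<tau>: "s \<le> t \<Longrightarrow> ereal t < \<tau> \<Longrightarrow> ereal s < \<tau>"
  by (meson ereal_less_eq(3) le_less_trans)

lemma \<phi>_gt_0: "0 < t \<Longrightarrow> ereal t < \<tau> \<Longrightarrow> 0 < \<phi> t"
  using \<phi>_pos by (auto simp: modulus_domain_def)

lemma \<phi>_le: "0 \<le> s \<Longrightarrow> s \<le> t \<Longrightarrow> ereal t < \<tau> \<Longrightarrow> \<phi> s \<le> \<phi> t"
  using \<phi>_mono less_\<tau>[of s t] by (auto simp: modulus_domain_def mono_on_def)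

lemma \<phi>_ge_0: "0 \<le> t \<Longrightarrow> ereal t < \<tau> \<Longrightarrow> 0 \<le> \<phi> t"
  using \<phi>_le[of 0 t] \<phi>_0 by simp

lemma inverse_antimono:
  assumes "0 < a" "ereal b < \<tau>" "a \<le> s" "s \<le> t" "t \<le> b"
  shows "1 / \<phi> t \<le> 1 / \<phi> s" "1 / sqrt (\<phi> t) \<le> 1 / sqrt (\<phi> s)"
  using \<phi>_gt_0[of s] \<phi>_gt_0[of t] \<phi>_le[of s t] less_\<tau>[of s b] less_\<tau>[of t b] assms
  by (auto intro!: divide_left_mono)

text \<open>Away from \<open>0\<close> the integrand is bounded, so additivity and differences can
  be handled in the reals instead of through \<open>Psi\<close> in \<open>ereal\<close>.\<close>

definition J :: "real \<Rightarrow> real \<Rightarrow> real" where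
  "J a b = integral {a..b} (\<lambda>s. 1 / \<phi> s)"

lemma J_integrable: "0 < a \<Longrightarrow> ereal b < \<tau> \<Longrightarrow> (\<lambda>s. 1 / \<phi> s) integrable_on {a..b}"
  using antimono_set_integrable[of a b "\<lambda>s. 1 / \<phi> s"] inverse_antimono(1)
    set_borel_integral_eq_integral(1) by blast

lemma J_combine: "0 < a \<Longrightarrow> a \<le> b \<Longrightarrow> b \<le> c \<Longrightarrow> ereal c < \<tau> \<Longrightarrow> J a c = J a b + J b c"
  unfolding J_def using Henstock_Kurzweil_Integration.integral_combine[OF _ _ J_integrable] by metis

lemma J_bounds:
  assumes "0 < a" "a \<le> b" "ereal b < \<tau>"
  shows "(b - a) / \<phi> b \<le> J a b" "J a b \<le> (b - a) / \<phi> a"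
  using antimono_integral_bounds[of a b "\<lambda>s. 1 / \<phi> s"] inverse_antimono(1) assms
  unfolding J_def by auto

lemma J_nonneg:
  assumes "0 < a" "a \<le> b" "ereal b < \<tau>"
  shows "0 \<le> J a b"
proof -
  have "0 \<le> (b - a) / \<phi> b"
    using \<phi>_gt_0[of b] assms by simp
  then show ?thesis
    using J_bounds(1)[OF assms] by linarith
qed

lemma nn_integral_inverse:
  assumes "0 < a" "a \<le> b" "ereal b < \<tau>"
  shows "(\<integral>\<^sup>+s\<in>{a..b}. ennreal (1 / \<phi> s) \<partial>lborel) = ennreal (J a b)"
proof -
  have si: "set_integrable lborel {a..b} (\<lambda>s. 1 / \<phi> s)"
    using antimono_set_integrable[of a b "\<lambda>s. 1 / \<phi> s"] inverse_antimono(1) assms by blast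
  have nn: "0 \<le> 1 / \<phi> s" if "s \<in> {a..b}" for s
    using that assms \<phi>_ge_0[of s] less_\<tau>[of s b] by auto
  have "(\<integral>\<^sup>+s\<in>{a..b}. ennreal (1 / \<phi> s) \<partial>lborel)
      = (\<integral>\<^sup>+s. ennreal (indicator {a..b} s *\<^sub>R (1 / \<phi> s)) \<partial>lborel)"
    by (intro nn_integral_cong) (auto simp: indicator_def)
  also have "\<dots> = ennreal (LBINT s:{a..b}. 1 / \<phi> s)"
    unfolding set_lebesgue_integral_def
    by (intro nn_integral_eq_integral)
      (use si nn in \<open>auto simp: set_integrable_def indicator_def\<close>)
  finally show ?thesis
    using set_borel_integral_eq_integral(2)[OF si] by (simp add: J_def)
qed

text \<open>If these integrals stayed below \<open>B\<close>, monotone convergence along left end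
  points tending to \<open>0\<close> would make \<open>1 / \<phi>\<close> integrable on
  \<open>{0..b}\<close>.\<close>

lemma J_unbounded:
  assumes b: "0 < b" "ereal b < \<tau>"
  obtains a where "0 < a" "a \<le> b" "B \<le> J a b"
proof -
  have "\<exists>a. 0 < a \<and> a \<le> b \<and> B \<le> J a b"
  proof (rule ccontr)
    assume "\<not> ?thesis"
    then have lt: "J a b < B" if "0 < a" "a \<le> b" for a
      using that by force
    let ?f = "\<lambda>s. indicator {0..b} s * (1 / \<phi> s)"
    let ?a = "\<lambda>n. b / real (Suc n)"
    let ?fn = "\<lambda>n s. ennreal (1 / \<phi> s) * indicator {?a n..b} s"
    have a: "0 < ?a n" "?a n \<le> b" for n
      using b by (auto simp: field_simps)
    have J_le: "J a b \<le> \<bar>B\<bar>" if "0 < a" "a \<le> b" for a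
      using lt[OF that] by simp
    let ?g = "\<lambda>s. \<phi> (max 0 (min b s))"
    have "mono ?g"
      using b by (intro monoI \<phi>_le less_\<tau>[OF _ b(2)]) auto
    then have g[measurable]: "?g \<in> borel_measurable borel"
      by (rule borel_measurable_mono)
    have "(\<lambda>s. indicator {0..b} s * (1 / ?g s)) = ?f"
      by (auto simp: indicator_def)
    moreover have "(\<lambda>s. indicator {0..b} s * (1 / ?g s)) \<in> borel_measurable borel"
      by measurable
    ultimately have meas[measurable]: "?f \<in> borel_measurable borel"
      by simp
    have fn: "?fn n = (\<lambda>s. ennreal (?f s) * indicator {?a n..b} s)" for n
    proof
      fix s
      show "?fn n s = ennreal (?f s) * indicator {?a n..b} s"
      proof (cases "s \<in> {?a n..b}")
        case True
        then have "s \<in> {0..b}"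
          using a(1)[of n] order_trans[of 0 "?a n" s] by (simp del: of_nat_Suc)
        then show ?thesis
          by simp
      next
        case False
        then show ?thesis
          by (simp del: of_nat_Suc)
      qed
    qed
    have lim: "(\<lambda>n. integral\<^sup>N lborel (?fn n)) \<longlonglongrightarrow> (\<integral>\<^sup>+s. ennreal (?f s) \<partial>lborel)"
    proof (rule nn_integral_LIMSEQ)
      show "incseq ?fn"
      proof (rule incseq_SucI, rule le_funI)
        fix n s
        have "{?a n..b} \<subseteq> {?a (Suc n)..b}"
          using b by (intro atLeastatMost_subset_iff[THEN iffD2] disjI2 conjI) (auto intro!: divide_left_mono)
        then have "(indicator {?a n..b} s :: ennreal) \<le> indicator {?a (Suc n)..b} s"
          by (rule indicator_le_mono)
        then show "?fn n s \<le> ?fn (Suc n) s"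
          by (intro mult_left_mono) auto
      qed
      show "?fn n \<in> borel_measurable lborel" for n
        unfolding fn by measurable
      show "(\<lambda>n. ?fn n s) \<longlonglongrightarrow> ennreal (?f s)" for s
      proof (cases "0 < s \<and> s \<le> b")
        case True
        have "?a \<longlonglongrightarrow> 0"
          by (rule LIMSEQ_Suc[OF lim_const_over_n])
        then have "\<forall>\<^sub>F n in sequentially. ?a n < s"
          using True by (auto dest: order_tendstoD(2))
        then have "\<forall>\<^sub>F n in sequentially. ?fn n s = ennreal (?f s)"
          by eventually_elim (use True in \<open>auto simp: indicator_def\<close>)
        then show ?thesis
          by (rule tendsto_eventually)
      next
        \<comment> \<open>At \<open>s = 0\<close> the limit is right because
          \<open>1 / \<phi> 0\<close> is \<open>1 / 0 = 0\<close>.\<close>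
        case False
        then have "?fn n s = 0" for n
          using a[of n] by (auto simp: indicator_def not_less simp del: of_nat_Suc)
        moreover have "?f s = 0"
          using False \<phi>_0 by (auto simp: indicator_def not_less)
        ultimately show ?thesis
          by (simp only: ennreal_0 tendsto_const)
      qed
    qed
    have "integral\<^sup>N lborel (?fn n) \<le> ennreal \<bar>B\<bar>" for n
      using nn_integral_inverse[of "?a n" b] a[of n] b J_le[of "?a n"]
      by (simp add: ennreal_leI)
    then have "(\<integral>\<^sup>+s. ennreal (?f s) \<partial>lborel) \<le> ennreal \<bar>B\<bar>"
      by (intro LIMSEQ_le_const2[OF lim]) auto
    then have fin: "(\<integral>\<^sup>+s. ennreal (?f s) \<partial>lborel) < \<infinity>"
      using ennreal_less_top le_less_trans by (metis infinity_ennreal_def)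
    have "0 \<le> ?f s" for s
      using \<phi>_ge_0[of s] less_\<tau>[OF _ b(2), of s] by (simp add: indicator_def)
    then have "integrable lborel ?f"
      by (intro integrableI_nonneg fin AE_I2) (use meas in simp)
    then have "set_integrable lborel {0..b} (\<lambda>s. 1 / \<phi> s)"
      by (simp add: set_integrable_def)
    then show False
      using inverse_not_integrable b by (auto simp: integrable_near_0_def)
  qed
  then show ?thesis
    using that by blast
qed

definition psi :: "real \<Rightarrow> real" where
  "psi t = (if t \<le> t0 then J t t0 else - J t0 t)"

lemma Psi_eq: "0 < t \<Longrightarrow> ereal t < \<tau> \<Longrightarrow> Psi \<phi> t0 t = ereal (psi t)"
  using t0_pos t0_less nn_integral_inverse[of t t0] nn_integral_inverse[of t0 t]
    J_nonneg[of t t0] J_nonneg[of t0 t]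
  by (auto simp: Psi_def psi_def enn2ereal_ennreal)

lemma psi_diff: 
  assumes "0 < a" "a \<le> b" "ereal b < \<tau>"
  shows "psi a = psi b + J a b"
proof -
  consider "b \<le> t0" | "a \<le> t0" "t0 < b" | "t0 < a" by linarith
  then show ?thesis
  proof cases
    case 1
    then show ?thesis
      using J_combine[of a b t0] assms t0_less by (simp add: psi_def)
  next
    case 2
    then show ?thesis
      using J_combine[of a t0 b] assms by (simp add: psi_def)
  next
    case 3
    then show ?thesis
      using J_combine[of t0 a b] assms t0_pos by (simp add: psi_def)
  qed
qed

lemma psi_t0: "psi t0 = 0"
  by (simp add: psi_def J_def)

lemma psi_less:
  assumes "0 < a" "a < b" "ereal b < \<tau>"
  shows "psi b < psi a"
proof -
  have "0 < (b - a) / \<phi> b"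
    using \<phi>_gt_0[of b] assms by simp
  then show ?thesis
    using psi_diff[of a b] J_bounds(1)[of a b] assms by simp
qed

text \<open>\<open>1 / \<phi>\<close> is smallest at the right end point. In use, \<open>b\<close>
  is the gap before a step and \<open>a\<close> the gap after it, so \<open>\<phi>\<close> is
  evaluated at the current gap, where it is at most \<open>g\<close>.\<close>

lemma psi_increment:
  assumes "0 < a" "a \<le> b" "ereal b < \<tau>"
  shows "psi b + (b - a) / \<phi> b \<le> psi a"
  using psi_diff[of a b] J_bounds(1)[of a b] assms by simp

lemma Psi_0: "Psi \<phi> t0 0 = \<infinity>"
proof -
  have "ennreal B \<le> (\<integral>\<^sup>+s\<in>{0..t0}. ennreal (1 / \<phi> s) \<partial>lborel)" for B
  proof -
    obtain a where a: "0 < a" "a \<le> t0" "B \<le> J a t0"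
      using J_unbounded[OF t0_pos t0_less] by blast
    have "ennreal B \<le> (\<integral>\<^sup>+s\<in>{a..t0}. ennreal (1 / \<phi> s) \<partial>lborel)"
      using a t0_less by (simp add: nn_integral_inverse ennreal_leI)
    also have "\<dots> \<le> (\<integral>\<^sup>+s\<in>{0..t0}. ennreal (1 / \<phi> s) \<partial>lborel)"
      using a by (intro nn_integral_mono) (auto simp: indicator_def)
    finally show ?thesis .
  qed
  then have "(\<integral>\<^sup>+s\<in>{0..t0}. ennreal (1 / \<phi> s) \<partial>lborel) = \<infinity>"
    by (rule ennreal_eq_top_of_ge)
  then show ?thesis
    using t0_pos by (simp add: Psi_def)
qed

lemma modulus_domain_cases:
  assumes "t \<in> modulus_domain \<tau>"
  obtains "t = 0" | "0 < t" "ereal t < \<tau>"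
  using assms by (auto simp: modulus_domain_def order_le_less)

lemma Psi_inj: "inj_on (Psi \<phi> t0) (modulus_domain \<tau>)"
proof (rule linorder_inj_onI')
  fix a b assume ab: "a \<in> modulus_domain \<tau>" "b \<in> modulus_domain \<tau>" "a < b"
  then have b: "0 < b" "ereal b < \<tau>"
    by (auto simp: modulus_domain_def)
  from ab(1) show "Psi \<phi> t0 a \<noteq> Psi \<phi> t0 b"
    by (cases rule: modulus_domain_cases) (use psi_less[of a b] ab(3) b in \<open>auto simp: Psi_eq Psi_0\<close>)
qed

text \<open>\<open>Psi\<close> is continuous away from \<open>0\<close> and unbounded near
  \<open>0\<close>, so the intermediate value theorem reaches every finite value above the one at
  \<open>v\<close>; the value \<open>\<infinity>\<close> is taken at \<open>0\<close>.\<close>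

lemma Psi_onto:
  assumes v: "v \<in> modulus_domain \<tau>" and u: "Psi \<phi> t0 v \<le> u"
  obtains t where "t \<in> modulus_domain \<tau>" "t \<le> v" "Psi \<phi> t0 t = u"
proof (cases "u = \<infinity>")
  case True
  then show ?thesis
    using that[of 0] v Psi_0 t0_pos t0_less less_\<tau>[of 0 t0] by (auto simp: modulus_domain_def)
next
  case False
  with v u have v: "0 < v" "ereal v < \<tau>" and "ereal (psi v) \<le> u"
    using Psi_0 Psi_eq by (auto elim!: modulus_domain_cases)
  with False obtain r where r: "u = ereal r" "psi v \<le> r"
    by (cases u) auto
  obtain a where a: "0 < a" "a \<le> v" "r - psi v \<le> J a v"
    using J_unbounded[OF v] by blast
  have "continuous_on {a..v} (\<lambda>t. psi v + integral {t..v} (\<lambda>s. 1 / \<phi> s))"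
    using J_integrable a v by (intro continuous_intros indefinite_integral_continuous_1')
  then have "continuous_on {a..v} psi"
    by (rule continuous_on_eq) (use psi_diff a v in \<open>auto simp: J_def\<close>)
  then obtain t where "a \<le> t" "t \<le> v" "psi t = r"
    using IVT2'[of psi v r a] psi_diff[of a v] a v r by auto
  then show ?thesis
    using that[of t] a v r Psi_eq[of t] less_\<tau>[of t v] by (auto simp: modulus_domain_def)
qed

text \<open>\<open>the_inv_into\<close> is meaningful only on the range, and \<open>v\<close>
  witnesses that \<open>u\<close> lies in it: \<open>V0\<close> for the bound in expectation,
  \<open>t0\<close> for the almost sure one.\<close>

lemma Psi_inv_props:
  assumes v: "v \<in> modulus_domain \<tau>" and u: "Psi \<phi> t0 v \<le> u"
  shows "Psi_inv \<tau> \<phi> t0 u \<in> modulus_domain \<tau>" "Psi_inv \<tau> \<phi> t0 u \<le> v"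
    "Psi \<phi> t0 (Psi_inv \<tau> \<phi> t0 u) = u"
proof -
  obtain t where t: "t \<in> modulus_domain \<tau>" "t \<le> v" "Psi \<phi> t0 t = u"
    using Psi_onto assms by blast
  then have "Psi_inv \<tau> \<phi> t0 u = t"
    unfolding Psi_inv_def using the_inv_into_f_eq[OF Psi_inj] by blast
  with t show "Psi_inv \<tau> \<phi> t0 u \<in> modulus_domain \<tau>" "Psi_inv \<tau> \<phi> t0 u \<le> v"
    "Psi \<phi> t0 (Psi_inv \<tau> \<phi> t0 u) = u"
    by auto
qed

lemma Psi_antimono:
  assumes "a \<in> modulus_domain \<tau>" "b \<in> modulus_domain \<tau>" "a \<le> b"
  shows "Psi \<phi> t0 b \<le> Psi \<phi> t0 a"
  using assms(1)
proof (cases rule: modulus_domain_cases)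
  case 2
  then show ?thesis
    using assms psi_less[of a b] Psi_eq[of a] Psi_eq[of b]
    by (cases "a = b") (auto simp: modulus_domain_def)
qed (simp add: Psi_0)

text \<open>Turns lower bounds for \<open>Psi\<close> of the gap into rates. If \<open>t\<close>
  were larger than the inverse value, antitonicity would force \<open>Psi\<close> to agree at two
  distinct points.\<close>

lemma le_Psi_inv:
  assumes "v \<in> modulus_domain \<tau>" "Psi \<phi> t0 v \<le> u"
    and "t \<in> modulus_domain \<tau>" "u \<le> Psi \<phi> t0 t"
  shows "t \<le> Psi_inv \<tau> \<phi> t0 u"
proof (rule ccontr)
  let ?s = "Psi_inv \<tau> \<phi> t0 u"
  note s = Psi_inv_props[OF assms(1,2)]
  assume "\<not> ?thesis"
  then have "Psi \<phi> t0 t \<le> Psi \<phi> t0 ?s" "t \<noteq> ?s"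
    using Psi_antimono[of ?s t] s assms by auto
  then show False
    using Psi_inj s assms by (auto dest: inj_onD)
qed

lemma Psi_inv_tendsto_0:
  assumes v: "v \<in> modulus_domain \<tau>" and u: "\<And>k. Psi \<phi> t0 v \<le> u k"
    and lim: "u \<longlonglongrightarrow> \<infinity>"
  shows "(\<lambda>k. Psi_inv \<tau> \<phi> t0 (u k)) \<longlonglongrightarrow> 0"
proof (rule LIMSEQ_I)
  fix e :: real assume e: "0 < e"
  define b where "b = min t0 (e / 2)"
  have b: "0 < b" "b \<in> modulus_domain \<tau>" "b < e"
    using e t0_pos t0_less less_\<tau>[of b t0] by (auto simp: b_def modulus_domain_def)
  then have "Psi \<phi> t0 b < \<infinity>"
    using Psi_eq[of b] by (simp add: modulus_domain_def)
  then have "\<forall>\<^sub>F k in sequentially. Psi \<phi> t0 b < u k"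
    using lim by (rule order_tendstoD(1)[rotated])
  then obtain N where N: "\<And>k. k \<ge> N \<Longrightarrow> Psi \<phi> t0 b < u k"
    by (auto simp: eventually_sequentially)
  have "norm (Psi_inv \<tau> \<phi> t0 (u k) - 0) < e" if "k \<ge> N" for k
  proof -
    have "Psi_inv \<tau> \<phi> t0 (u k) \<le> b"
      by (rule Psi_inv_props(2)[OF b(2)]) (use N[OF that] in auto)
    moreover have "0 \<le> Psi_inv \<tau> \<phi> t0 (u k)"
      using Psi_inv_props(1)[OF v u[of k]] by (simp add: modulus_domain_def)
    ultimately show ?thesis
      using b by simp
  qed
  then show "\<exists>N. \<forall>k\<ge>N. norm (Psi_inv \<tau> \<phi> t0 (u k) - 0) < e"
    by blast
qed

end

section \<open>\<open>Phi\<close> as a concave function\<close>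

locale sqrt_integrable_modulus = error_bound_modulus +
  assumes inverse_sqrt_integrable: "integrable_near_0 \<tau> (\<lambda>s. 1 / sqrt (\<phi> s))"
begin

lemma inverse_sqrt_set_integrable:
  assumes b: "ereal b < \<tau>"
  shows "set_integrable lborel {0..b} (\<lambda>s. 1 / sqrt (\<phi> s))"
proof -
  obtain r where r: "0 < r" "ereal r < \<tau>" "set_integrable lborel {0..r} (\<lambda>s. 1 / sqrt (\<phi> s))"
    using inverse_sqrt_integrable by (auto simp: integrable_near_0_def)
  have "set_integrable lborel {r..b} (\<lambda>s. 1 / sqrt (\<phi> s))"
    using antimono_set_integrable[of r b "\<lambda>s. 1 / sqrt (\<phi> s)"] inverse_antimono(2) r b by blast
  with r have "set_integrable lborel ({0..r} \<union> {r..b}) (\<lambda>s. 1 / sqrt (\<phi> s))"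
    by (intro set_integrable_Un) auto
  then show ?thesis
    by (rule set_integrable_subset) auto
qed

lemma inverse_sqrt_integrable_on:
  assumes "0 \<le> a" "ereal b < \<tau>"
  shows "(\<lambda>s. 1 / sqrt (\<phi> s)) integrable_on {a..b}"
  by (rule integrable_subinterval_real
      [OF set_borel_integral_eq_integral(1)[OF inverse_sqrt_set_integrable[OF assms(2)]]])
    (use assms in auto)

lemma Phi_eq: "ereal t < \<tau> \<Longrightarrow> Phi \<phi> t = integral {0..t} (\<lambda>s. 1 / sqrt (\<phi> s))"
  unfolding Phi_def by (rule set_borel_integral_eq_integral(2)[OF inverse_sqrt_set_integrable])

lemma Phi_diff:
  assumes "0 \<le> a" "a \<le> b" "ereal b < \<tau>"
  shows "Phi \<phi> b - Phi \<phi> a = integral {a..b} (\<lambda>s. 1 / sqrt (\<phi> s))"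
  using Phi_eq[of a] Phi_eq[of b] less_\<tau>[of a b]
    Henstock_Kurzweil_Integration.integral_combine[OF assms(1,2) inverse_sqrt_integrable_on[of 0 b]] assms by simp

lemma Phi_0: "Phi \<phi> 0 = 0"
  using Phi_eq[of 0] less_\<tau>[of 0 t0] t0_pos t0_less by simp

lemma Phi_mono:
  assumes "0 \<le> a" "a \<le> b" "ereal b < \<tau>"
  shows "Phi \<phi> a \<le> Phi \<phi> b"
proof -
  have "0 \<le> integral {a..b} (\<lambda>s. 1 / sqrt (\<phi> s))"
    using assms \<phi>_ge_0 less_\<tau>[of _ b]
    by (intro integral_nonneg inverse_sqrt_integrable_on) auto
  then show ?thesis
    using Phi_diff[OF assms] by simp
qed

lemma Phi_nonneg: "0 \<le> a \<Longrightarrow> ereal a < \<tau> \<Longrightarrow> 0 \<le> Phi \<phi> a"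
  using Phi_mono[of 0 a] Phi_0 by simp

lemma Phi_continuous: "ereal b < \<tau> \<Longrightarrow> continuous_on {0..b} (Phi \<phi>)"
  by (rule continuous_on_eq[OF indefinite_integral_continuous_1[OF inverse_sqrt_integrable_on[of 0 b]]])
    (auto simp: Phi_eq less_\<tau>[of _ b])

lemma Phi_tendsto_0:
  assumes lim: "v \<longlonglongrightarrow> 0" and v: "\<And>k. v k \<in> modulus_domain \<tau>"
  shows "(\<lambda>k. Phi \<phi> (v k)) \<longlonglongrightarrow> 0"
proof -
  have ev: "\<forall>\<^sub>F k in sequentially. v k \<in> {0..t0}"
    using order_tendstoD(2)[OF lim t0_pos] by eventually_elim (use v in \<open>auto simp: modulus_domain_def\<close>)
  have "(\<lambda>k. Phi \<phi> (v k)) \<longlonglongrightarrow> Phi \<phi> 0"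
    by (rule continuous_on_tendsto_compose[OF Phi_continuous[OF t0_less] lim _ ev])
      (use t0_pos in auto)
  then show ?thesis
    by (simp add: Phi_0)
qed

lemma Phi_increment_upper:
  assumes "0 < a" "a \<le> b" "ereal b < \<tau>"
  shows "Phi \<phi> b - Phi \<phi> a \<le> (b - a) / sqrt (\<phi> a)"
  using antimono_integral_bounds(2)[of a b "\<lambda>s. 1 / sqrt (\<phi> s)"] inverse_antimono(2)
    Phi_diff[of a b] assms by auto

lemma Phi_increment_lower:
  assumes "0 \<le> a" "a \<le> b" "ereal b < \<tau>"
  shows "(b - a) / sqrt (\<phi> b) \<le> Phi \<phi> b - Phi \<phi> a"
proof -
  have 1: "(b - a) / sqrt (\<phi> b) \<le> Phi \<phi> b - Phi \<phi> a" if "0 < a" "a \<le> b" for a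
    using antimono_integral_bounds(1)[of a b "\<lambda>s. 1 / sqrt (\<phi> s)"] inverse_antimono(2)
      Phi_diff[of a b] that assms by auto
  show ?thesis
  proof (cases "0 < a \<or> b = 0")
    case True
    then show ?thesis
      using 1 assms by auto
  next
    \<comment> \<open>At \<open>a = 0\<close> the integrand is not antitone, since its value at
      \<open>0\<close> is \<open>1 / 0 = 0\<close>. The bound is obtained as a limit from positive
      left end points.\<close>
    case False
    with assms have ab: "a = 0" "0 < b" by auto
    have "(b - e) / sqrt (\<phi> b) \<le> Phi \<phi> b" if "0 < e" "e \<le> b" for e
      using 1[of e] that Phi_nonneg[of e] less_\<tau>[of e b] assms by force
    then have "\<forall>\<^sub>F e in at_right 0. (b - e) / sqrt (\<phi> b) \<le> Phi \<phi> b"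
      using ab by (auto simp: eventually_at_right_field intro!: exI[of _ b])
    moreover have "((\<lambda>e. (b - e) / sqrt (\<phi> b)) \<longlongrightarrow> (b - 0) / sqrt (\<phi> b)) (at_right 0)"
      using \<phi>_gt_0[of b] ab assms by (intro tendsto_intros) auto
    ultimately have "(b - 0) / sqrt (\<phi> b) \<le> Phi \<phi> b"
      by (intro tendsto_upperbound[of _ _ "at_right 0"]) auto
    then show ?thesis
      using ab Phi_0 by simp
  qed
qed

text \<open>Concavity: the integrand is non-increasing on positive arguments, so
  \<open>1 / sqrt (\<phi> m)\<close> is a supergradient at \<open>m\<close> even where
  \<open>Phi\<close> has no derivative.\<close>

lemma Phi_tangent:
  assumes "0 < m" "ereal m < \<tau>" "0 \<le> v" "ereal v < \<tau>"
  shows "Phi \<phi> v \<le> Phi \<phi> m + (v - m) / sqrt (\<phi> m)"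
proof (cases "v \<le> m")
  case True
  then show ?thesis
    using Phi_increment_lower[of v m] assms by (simp add: diff_divide_distrib)
next
  case False
  then show ?thesis
    using Phi_increment_upper[of m v] assms by simp
qed

text \<open>On \<open>{a..b}\<close> one of the two factors \<open>1 / sqrt (\<phi> s)\<close> of
  \<open>1 / \<phi> s\<close> is at most \<open>1 / sqrt (\<phi> a)\<close>. Applied between
  consecutive rates, where the increment of \<open>psi\<close> is exactly
  \<open>c1 * c2 / 2 * \<alpha> k\<close>, it bounds a stepsize by a decrement of
  \<open>Phi\<close>.\<close>

lemma psi_diff_le_Phi_diff:
  assumes "0 < a" "a \<le> b" "ereal b < \<tau>"
  shows "sqrt (\<phi> a) * (psi a - psi b) \<le> Phi \<phi> b - Phi \<phi> a"
proof -
  have a: "0 < \<phi> a"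
    using \<phi>_gt_0[of a] less_\<tau>[of a b] assms by simp
  have "sqrt (\<phi> a) * J a b = integral {a..b} (\<lambda>s. sqrt (\<phi> a) * (1 / \<phi> s))"
    unfolding J_def by (rule integral_mult_right[symmetric])
  also have "\<dots> \<le> integral {a..b} (\<lambda>s. 1 / sqrt (\<phi> s))"
  proof (rule integral_le)
    show "(\<lambda>s. sqrt (\<phi> a) * (1 / \<phi> s)) integrable_on {a..b}"
      using J_integrable[of a b] assms by (intro integrable_on_mult_right)
    show "(\<lambda>s. 1 / sqrt (\<phi> s)) integrable_on {a..b}"
      using assms by (intro inverse_sqrt_integrable_on) auto
    fix s assume s: "s \<in> {a..b}"
    then have "\<phi> a \<le> \<phi> s"
      using assms less_\<tau>[of s b] by (intro \<phi>_le) auto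
    then have "sqrt (\<phi> a) * (1 / \<phi> s) \<le> sqrt (\<phi> s) / \<phi> s"
      using a by (simp add: divide_right_mono)
    also have "\<dots> = 1 / sqrt (\<phi> s)"
      using \<open>\<phi> a \<le> \<phi> s\<close> a by (simp add: real_div_sqrt field_simps)
    finally show "sqrt (\<phi> a) * (1 / \<phi> s) \<le> 1 / sqrt (\<phi> s)" .
  qed
  finally show ?thesis
    using psi_diff[OF assms] Phi_diff[of a b] assms by simp
qed

end

subsection \<open>Series of random variables and random indices\<close>

lemma exp_chord:
  fixes y u :: real
  assumes "0 \<le> u" "u \<le> 1"
  shows "exp (u * y) \<le> 1 - u + u * exp y"
  using convex_onD[OF exp_convex assms, of 0 y] by simp

text \<open>Monotone convergence exchanges sum and expectation. It serves twice: for the weighted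
  exponential moments and for the lengths of paths.\<close>

lemma
  fixes f :: "nat \<Rightarrow> 'a \<Rightarrow> real"
  assumes int: "\<And>k. integrable M (f k)"
    and nonneg: "\<And>k \<omega>. \<omega> \<in> space M \<Longrightarrow> 0 \<le> f k \<omega>"
    and bound: "\<And>n. (\<Sum>k<n. \<integral>\<omega>. f k \<omega> \<partial>M) \<le> C"
  shows AE_summable_if_sum_integral_le: "AE \<omega> in M. summable (\<lambda>k. f k \<omega>)"
    and integrable_suminf_if_sum_integral_le: "integrable M (\<lambda>\<omega>. \<Sum>k. f k \<omega>)"
    and integral_suminf_le: "(\<integral>\<omega>. (\<Sum>k. f k \<omega>) \<partial>M) \<le> C"
proof -
  note [measurable] = borel_measurable_integrable[OF int]
  have pos: "0 \<le> (\<integral>\<omega>. f k \<omega> \<partial>M)" for k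
    using nonneg by (intro integral_nonneg_AE AE_I2) auto
  have sums: "summable (\<lambda>k. \<integral>\<omega>. f k \<omega> \<partial>M)"
    by (rule summableI_nonneg_bounded[OF pos bound])
  have nn: "(\<integral>\<^sup>+\<omega>. ennreal (f k \<omega>) \<partial>M) = ennreal (\<integral>\<omega>. f k \<omega> \<partial>M)" for k
    using int nonneg by (intro nn_integral_eq_integral AE_I2) auto
  have "(\<integral>\<^sup>+\<omega>. (\<Sum>k. ennreal (f k \<omega>)) \<partial>M) = (\<Sum>k. ennreal (\<integral>\<omega>. f k \<omega> \<partial>M))"
    by (subst nn_integral_suminf) (auto simp: nn)
  also have "\<dots> \<noteq> \<infinity>"
    using sums pos by (simp add: suminf_ennreal_eq[OF pos summable_sums[OF sums]])
  finally have "AE \<omega> in M. (\<Sum>k. ennreal (f k \<omega>)) \<noteq> \<infinity>"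
    by (intro nn_integral_noteq_infinite) auto
  then show summ: "AE \<omega> in M. summable (\<lambda>k. f k \<omega>)"
    using AE_space by eventually_elim (use nonneg in \<open>auto intro: summable_suminf_not_top\<close>)
  have "(\<integral>\<omega>. norm (f k \<omega>) \<partial>M) = (\<integral>\<omega>. f k \<omega> \<partial>M)" for k
    using nonneg by (intro Bochner_Integration.integral_cong) auto
  then have sums': "summable (\<lambda>k. \<integral>\<omega>. norm (f k \<omega>) \<partial>M)"
    using sums by simp
  have summ': "AE \<omega> in M. summable (\<lambda>k. norm (f k \<omega>))"
    using summ AE_space
  proof eventually_elim
    case (elim \<omega>)
    then have "(\<lambda>k. norm (f k \<omega>)) = (\<lambda>k. f k \<omega>)"
      using nonneg by auto
    then show ?case
      using elim by simp
  qed
  show "integrable M (\<lambda>\<omega>. \<Sum>k. f k \<omega>)"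
    by (rule integrable_suminf[OF int summ' sums'])
  have "(\<integral>\<omega>. (\<Sum>k. f k \<omega>) \<partial>M) = (\<Sum>k. \<integral>\<omega>. f k \<omega> \<partial>M)"
    by (rule integral_suminf[OF int summ' sums'])
  also have "\<dots> \<le> C"
    using sums bound by (rule suminf_le_const)
  finally show "(\<integral>\<omega>. (\<Sum>k. f k \<omega>) \<partial>M) \<le> C" .
qed

text \<open>\<open>K\<close> is the first index from which on \<open>P\<close> holds forever, and
  \<open>\<infinity>\<close> if there is none. Hence the last conclusion holds at every point, and
  only finiteness is almost sure.\<close>

lemma AE_eventually_imp_random_index:
  fixes P :: "nat \<Rightarrow> 'a \<Rightarrow> bool"
  assumes [measurable]: "\<And>k. Measurable.pred M (P k)"
    and ev: "AE \<omega> in M. \<forall>\<^sub>F k in sequentially. P k \<omega>"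
  obtains K :: "'a \<Rightarrow> enat" where "K \<in> M \<rightarrow>\<^sub>M count_space UNIV" "AE \<omega> in M. K \<omega> < \<infinity>"
    "\<And>\<omega> k. K \<omega> \<le> enat k \<Longrightarrow> P k \<omega>"
proof -
  define Q where "Q n \<omega> \<longleftrightarrow> (\<forall>k\<ge>n. P k \<omega>)" for n \<omega>
  have [measurable]: "Measurable.pred M (Q n)" for n
    unfolding Q_def by measurable
  define K where "K \<omega> = (if \<exists>n. Q n \<omega> then enat (LEAST n. Q n \<omega>) else \<infinity>)" for \<omega>
  show ?thesis
  proof
    show "K \<in> M \<rightarrow>\<^sub>M count_space UNIV"
      unfolding K_def by measurable
    show "AE \<omega> in M. K \<omega> < \<infinity>"
      using ev by eventually_elim (auto simp: K_def Q_def eventually_sequentially)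
    show "P k \<omega>" if K: "K \<omega> \<le> enat k" for \<omega> k
    proof -
      have ex: "\<exists>n. Q n \<omega>"
        using K by (auto simp: K_def split: if_splits)
      then have "Q (LEAST n. Q n \<omega>) \<omega>"
        by (rule LeastI_ex)
      moreover have "(LEAST n. Q n \<omega>) \<le> k"
        using K ex by (simp add: K_def)
      ultimately obtain m where "Q m \<omega>" "m \<le> k"
        by blast
      then show ?thesis
        by (simp add: Q_def)
    qed
  qed
qed

text \<open>A Riemann sum for the integral of \<open>exp (- \<delta> a)\<close> over \<open>a \<ge> 0\<close>.\<close>

lemma sum_weighted_exp_le:
  fixes \<alpha> :: "nat \<Rightarrow> real"
  assumes \<alpha>: "\<And>k. 0 < \<alpha> k" "\<And>k. \<alpha> k \<le> b" and \<delta>: "0 < \<delta>"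
  shows "(\<Sum>k<n. \<alpha> k * exp (- \<delta> * (\<Sum>i<k. \<alpha> i))) \<le> (1 + \<delta> * b) / \<delta>"
proof -
  define A where "A k = (\<Sum>i<k. \<alpha> i)" for k
  have b: "0 < b"
    using \<alpha>[of 0] by linarith
  have term_le: "\<alpha> k * exp (- \<delta> * A k)
      \<le> (1 + \<delta> * b) / \<delta> * (exp (- \<delta> * A k) - exp (- \<delta> * A (Suc k)))" for k
  proof -
    let ?y = "\<delta> * \<alpha> k"
    have y: "0 < ?y" "?y \<le> \<delta> * b"
      using \<alpha>[of k] \<delta> by auto
    \<comment> \<open>The left Riemann sum exceeds the integral over one step by at most the factor
      \<open>1 + ?y\<close>, hence by at most \<open>1 + \<delta> * b\<close>; the integrals
      telescope.\<close>
    have "exp (- ?y) \<le> 1 / (1 + ?y)"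
      using exp_ge_add_one_self[of ?y] y by (simp add: exp_minus field_simps)
    then have "?y / (1 + ?y) \<le> 1 - exp (- ?y)"
      using y by (simp add: field_simps)
    moreover have "?y / (1 + \<delta> * b) \<le> ?y / (1 + ?y)"
      using y by (intro divide_left_mono) auto
    ultimately have "?y / (1 + \<delta> * b) \<le> 1 - exp (- ?y)"
      by linarith
    then have "\<alpha> k \<le> (1 + \<delta> * b) / \<delta> * (1 - exp (- ?y))"
      using y \<delta> b by (simp add: field_simps add_pos_pos)
    then have "\<alpha> k * exp (- \<delta> * A k) \<le> (1 + \<delta> * b) / \<delta> * (1 - exp (- ?y)) * exp (- \<delta> * A k)"
      by (rule mult_right_mono) simp
    moreover have "(1 - exp (- ?y)) * exp (- \<delta> * A k) = exp (- \<delta> * A k) - exp (- \<delta> * A (Suc k))"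
      by (simp add: A_def algebra_simps flip: exp_add)
    ultimately show ?thesis
      by (simp only: mult.assoc)
  qed
  have "(\<Sum>k<n. \<alpha> k * exp (- \<delta> * A k))
      \<le> (\<Sum>k<n. (1 + \<delta> * b) / \<delta> * (exp (- \<delta> * A k) - exp (- \<delta> * A (Suc k))))"
    by (intro sum_mono term_le)
  also have "\<dots> = (1 + \<delta> * b) / \<delta> * (exp (- \<delta> * A 0) - exp (- \<delta> * A n))"
    by (subst sum_lessThan_telescope'[symmetric]) (simp add: sum_distrib_left)
  also have "\<dots> \<le> (1 + \<delta> * b) / \<delta> * 1"
    using b \<delta> by (intro mult_left_mono) (auto simp: A_def)
  finally show ?thesis
    by (simp add: A_def)
qed

section \<open>Gaps, normalised steps and weighted sums\<close>

locale mra_error_bound =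
  monotone_randomized_algorithm M F x x0 S g h c1 c2 c3 \<alpha> + error_bound_modulus \<tau> \<phi> t0
  for M :: "'a measure" and F and x :: "nat \<Rightarrow> 'a \<Rightarrow> real ^ 'd" and x0 S g h c1 c2 c3 \<alpha> \<tau> \<phi> t0 +
  fixes abar :: real
  assumes stepsize: "stepsize_condition \<alpha> abar"
    and error_bound: "global_unified_error_bound S g h \<tau> \<phi>"
begin

definition V :: "nat \<Rightarrow> 'a \<Rightarrow> real" where
  "V k \<omega> = h (x k \<omega>) - (INF z\<in>S. h z)"

definition V0 :: real where
  "V0 = h x0 - (INF z\<in>S. h z)"

definition d :: "nat \<Rightarrow> 'a \<Rightarrow> real" where
  "d k \<omega> = norm (x (Suc k) \<omega> - x k \<omega>)"

definition A :: "nat \<Rightarrow> real" where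
  "A k = (\<Sum>i<k. \<alpha> i)"

definition p :: real where
  "p = c2 / c3"

text \<open>The value \<open>1\<close> at stationary points keeps the conditional mean of \<open>D k\<close> at least \<open>p\<close> there.\<close>

definition D :: "nat \<Rightarrow> 'a \<Rightarrow> real" where
  "D k \<omega> = (if g (x k \<omega>) = 0 then 1 else (d k \<omega>)\<^sup>2 / (c3 * (\<alpha> k)\<^sup>2 * g (x k \<omega>)))"

definition W :: "nat \<Rightarrow> 'a \<Rightarrow> real" where
  "W k \<omega> = (\<Sum>i<k. \<alpha> i * D i \<omega>)"

lemma abar_pos: "0 < abar" and \<alpha>_le: "\<alpha> k \<le> abar"
  and A_at_top: "filterlim A at_top sequentially"
  using stepsize by (auto simp: stepsize_condition_def A_def[abs_def])

lemma A_0 [simp]: "A 0 = 0" and A_Suc: "A (Suc k) = A k + \<alpha> k"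
  by (simp_all add: A_def)

lemma A_nonneg: "0 \<le> A k"
  unfolding A_def by (intro sum_nonneg less_imp_le \<alpha>_pos)

lemma scaled_A_at_top: "0 < c \<Longrightarrow> filterlim (\<lambda>k. c * A k) at_top sequentially"
  by (rule filterlim_tendsto_pos_mult_at_top[OF tendsto_const _ A_at_top])

lemma A_tendsto_PInf: "(\<lambda>k. ereal (c1 * c2 / 2 * A k)) \<longlonglongrightarrow> \<infinity>"
  using scaled_A_at_top[of "c1 * c2 / 2"] c1_pos c2_pos by (simp add: tendsto_PInfty_eq_at_top)

lemma p_pos: "0 < p" and p_le_1: "p \<le> 1"
  using c2_pos c3_pos c2_le_c3 by (auto simp: p_def)

lemma x0_in_S: "x0 \<in> S"
  using not_empty in_S[of _ 0] deterministic_start by fastforce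

lemma V0_domain: "V0 \<in> modulus_domain \<tau>"
  using error_bound x0_in_S by (auto simp: global_unified_error_bound_def V0_def)

lemma V_domain: "\<omega> \<in> space M \<Longrightarrow> V k \<omega> \<in> modulus_domain \<tau>"
  using error_bound in_S by (auto simp: global_unified_error_bound_def V_def)

lemma V_nonneg: "\<omega> \<in> space M \<Longrightarrow> 0 \<le> V k \<omega>" and V_less_\<tau>: "\<omega> \<in> space M \<Longrightarrow> ereal (V k \<omega>) < \<tau>"
  using V_domain by (auto simp: modulus_domain_def)

lemma V_start: "\<omega> \<in> space M \<Longrightarrow> V 0 \<omega> = V0"
  using deterministic_start by (simp add: V_def V0_def)

lemma \<phi>_V_le_g: "\<omega> \<in> space M \<Longrightarrow> \<phi> (V k \<omega>) \<le> g (x k \<omega>)"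
  using error_bound in_S by (auto simp: global_unified_error_bound_def V_def)

lemma g_x_nonneg: "\<omega> \<in> space M \<Longrightarrow> 0 \<le> g (x k \<omega>)"
  using g_nonneg in_S by blast

lemma d_sq_le: "\<omega> \<in> space M \<Longrightarrow> (d k \<omega>)\<^sup>2 \<le> \<alpha> k / c1 * (V k \<omega> - V (Suc k) \<omega>)"
  using sufficient_decrease[of \<omega> k] c1_pos \<alpha>_pos[of k] by (simp add: d_def V_def field_simps)

lemma d_sq_le_g: "\<omega> \<in> space M \<Longrightarrow> (d k \<omega>)\<^sup>2 \<le> c3 * (\<alpha> k)\<^sup>2 * g (x k \<omega>)"
  using step_upper by (simp add: d_def)

lemma V_Suc_le:
  assumes "\<omega> \<in> space M"
  shows "V (Suc k) \<omega> \<le> V k \<omega>"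
proof -
  have "0 \<le> \<alpha> k / c1 * (V k \<omega> - V (Suc k) \<omega>)"
    by (rule order_trans[OF zero_le_power2 d_sq_le[OF assms]])
  then show ?thesis
    using c1_pos \<alpha>_pos[of k] by (simp add: zero_le_mult_iff zero_le_divide_iff)
qed

lemma V_le_V0: "\<omega> \<in> space M \<Longrightarrow> V k \<omega> \<le> V0"
  by (induction k) (auto simp: V_start intro: order_trans[OF V_Suc_le])

lemma D_nonneg: "\<omega> \<in> space M \<Longrightarrow> 0 \<le> D k \<omega>"
  using g_x_nonneg c3_pos by (auto simp: D_def)

lemma D_le_1: "\<omega> \<in> space M \<Longrightarrow> D k \<omega> \<le> 1"
  using g_x_nonneg[of \<omega> k] d_sq_le_g[of \<omega> k] c3_pos \<alpha>_pos[of k]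
  by (auto simp: D_def divide_le_eq_1)

lemma W_Suc: "W (Suc k) \<omega> = W k \<omega> + \<alpha> k * D k \<omega>"
  by (simp add: W_def)

lemma W_nonneg: "\<omega> \<in> space M \<Longrightarrow> 0 \<le> W k \<omega>"
  unfolding W_def using \<alpha>_pos less_imp_le by (intro sum_nonneg mult_nonneg_nonneg D_nonneg) auto

subsection \<open>Measurability\<close>

lemma measurable_from_F: "f \<in> borel_measurable (F k) \<Longrightarrow> f \<in> borel_measurable M"
  using measurable_from_subalg[OF subalgebra_F] .

lemma x_measurable_F: "i \<le> k \<Longrightarrow> x i \<in> borel_measurable (F k)"
  by (rule measurable_from_subalg[OF _ adapted[of i]])
    (auto simp: subalgebra_def space_F intro: subsetD[OF sets_F_mono])

text \<open>Nothing is known about \<open>f\<close> off \<open>S\<close>. Cutting it off by the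
  indicator of the closed set \<open>S\<close> gives a Borel function that agrees with
  \<open>f\<close> along the iterates.\<close>

lemma continuous_x_measurable_F:
  fixes f :: "real ^ 'd \<Rightarrow> real"
  assumes "continuous_on S f" "i \<le> k"
  shows "(\<lambda>\<omega>. f (x i \<omega>)) \<in> borel_measurable (F k)"
proof -
  have "(\<lambda>\<omega>. indicator S (x i \<omega>) *\<^sub>R f (x i \<omega>)) \<in> borel_measurable (F k)"
    using borel_measurable_continuous_on_indicator[OF borel_closed[OF closed_S] assms(1)]
      x_measurable_F[OF assms(2)] by (rule measurable_compose[rotated])
  then show ?thesis
    by (rule iffD1[OF measurable_cong, rotated]) (use in_S in \<open>simp add: space_F\<close>)
qed

lemma g_measurable_F: "i \<le> k \<Longrightarrow> (\<lambda>\<omega>. g (x i \<omega>)) \<in> borel_measurable (F k)"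
  by (rule continuous_x_measurable_F[OF continuous_g])

lemma x_measurable [measurable]: "x i \<in> borel_measurable M"
  using measurable_from_F x_measurable_F by blast

lemma g_measurable [measurable]: "(\<lambda>\<omega>. g (x i \<omega>)) \<in> borel_measurable M"
  using measurable_from_F g_measurable_F by blast

lemma V_measurable [measurable]: "V k \<in> borel_measurable M"
  unfolding V_def[abs_def]
  using measurable_from_F[OF continuous_x_measurable_F[OF continuous_h order_refl]]
  by (rule borel_measurable_diff) simp

lemma d_measurable [measurable]: "d k \<in> borel_measurable M"
  unfolding d_def[abs_def] by measurable

lemma D_measurable_F:
  assumes "i < k"
  shows "D i \<in> borel_measurable (F k)"
proof -
  have [measurable]: "x i \<in> borel_measurable (F k)" "x (Suc i) \<in> borel_measurable (F k)"
    "(\<lambda>\<omega>. g (x i \<omega>)) \<in> borel_measurable (F k)"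
    using assms by (auto intro!: x_measurable_F g_measurable_F)
  show ?thesis
    unfolding D_def[abs_def] d_def by measurable
qed

lemma D_measurable [measurable]: "D k \<in> borel_measurable M"
  using measurable_from_F D_measurable_F by blast

lemma W_measurable_F: "W k \<in> borel_measurable (F k)"
  unfolding W_def[abs_def] by (intro borel_measurable_sum borel_measurable_times D_measurable_F) auto

lemma W_measurable [measurable]: "W k \<in> borel_measurable M"
  using measurable_from_F W_measurable_F by blast

lemma integrable_bounded:
  fixes f :: "'a \<Rightarrow> real"
  assumes "f \<in> borel_measurable M" "\<And>\<omega>. \<omega> \<in> space M \<Longrightarrow> \<bar>f \<omega>\<bar> \<le> B"
  shows "integrable M f"
  using assms by (intro integrable_const_bound[of _ B] AE_I2) auto

lemma V_integrable: "integrable M (V k)"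
  by (rule integrable_bounded[of _ V0]) (use V_nonneg V_le_V0 in auto)

lemma exp_W_integrable:
  assumes "0 \<le> l"
  shows "integrable M (\<lambda>\<omega>. exp (- l * W k \<omega>))"
  by (rule integrable_bounded[of _ 1]) (use W_nonneg assms in auto)

subsection \<open>The decrease along a path\<close>

text \<open>Sufficient decrease bounds \<open>(d k \<omega>)\<^sup>2 / \<alpha> k\<close> by a
  multiple of the drop of the gap, and \<open>\<phi> \<le> g\<close> at the gap allows comparing
  that drop with the integral of \<open>1 / \<phi>\<close>.\<close>

lemma Psi_V_ge:
  assumes \<omega>: "\<omega> \<in> space M"
  shows "Psi \<phi> t0 V0 + ereal (c1 * c3 * W k \<omega>) \<le> Psi \<phi> t0 (V k \<omega>)"
proof (induction k)
  case 0
  then show ?case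
    using V_start[OF \<omega>] by (simp add: W_def)
next
  case (Suc k)
  let ?v = "V k \<omega>" and ?v' = "V (Suc k) \<omega>" and ?g = "g (x k \<omega>)"
  show ?case
  proof (cases "?v' = 0")
    \<comment> \<open>Once the minimum is reached, \<open>Psi\<close> is infinite by divergence of
      the integral at \<open>0\<close>, and any further growth of \<open>W\<close> is
      harmless.\<close>
    case True
    then show ?thesis
      by (simp add: Psi_0)
  next
    case False
    then have v': "0 < ?v'" "?v' \<le> ?v" "ereal ?v < \<tau>" "ereal ?v' < \<tau>"
      using V_nonneg[OF \<omega>, of "Suc k"] V_Suc_le[OF \<omega>] V_less_\<tau>[OF \<omega>] by auto
    then have \<phi>: "0 < \<phi> ?v" and g: "\<phi> ?v \<le> ?g"
      using \<phi>_gt_0 \<phi>_V_le_g[OF \<omega>] by auto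
    \<comment> \<open>\<open>g\<close> is positive here, so the default value in \<open>D\<close>
      does not occur.\<close>
    then have "c1 * c3 * (\<alpha> k * D k \<omega>) = c1 * (d k \<omega>)\<^sup>2 / (\<alpha> k * ?g)"
      using \<alpha>_pos[of k] c3_pos by (simp add: D_def field_simps power2_eq_square)
    also have "\<dots> \<le> c1 * (\<alpha> k / c1 * (?v - ?v')) / (\<alpha> k * ?g)"
      using d_sq_le[OF \<omega>, of k] c1_pos \<alpha>_pos[of k] \<phi> g
      by (intro divide_right_mono mult_left_mono) auto
    also have "\<dots> = (?v - ?v') / ?g"
      using c1_pos \<alpha>_pos[of k] by simp
    also have "\<dots> \<le> (?v - ?v') / \<phi> ?v"
      using \<phi> g v' by (intro divide_left_mono) auto
    also have "\<dots> \<le> psi ?v' - psi ?v"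
      using psi_increment[OF v'(1,2,3)] by simp
    finally have incr: "c1 * c3 * (\<alpha> k * D k \<omega>) \<le> psi ?v' - psi ?v" .
    have "Psi \<phi> t0 V0 + ereal (c1 * c3 * W (Suc k) \<omega>)
        = Psi \<phi> t0 V0 + ereal (c1 * c3 * W k \<omega>) + ereal (c1 * c3 * (\<alpha> k * D k \<omega>))"
      by (simp add: W_Suc distrib_left add.assoc)
    also have "\<dots> \<le> ereal (psi ?v) + ereal (psi ?v' - psi ?v)"
      using Suc incr v' by (intro add_mono) (auto simp: Psi_eq)
    finally show ?thesis
      using v' by (simp add: Psi_eq)
  qed
qed

subsection \<open>Concentration of the weighted sums\<close>

text \<open>The conditional bound is tested against a weight known at time \<open>k\<close>. The
  weight may blow up like a power of \<open>1 / g\<close>; integrability of the weighted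
  \<open>g\<close> is drawn from that of the weighted squared step.\<close>

lemma expected_step_weighted:
  assumes Y: "Y \<in> borel_measurable (F k)" and nonneg: "\<And>\<omega>. \<omega> \<in> space M \<Longrightarrow> 0 \<le> Y \<omega>"
    and int: "integrable M (\<lambda>\<omega>. Y \<omega> * (d k \<omega>)\<^sup>2)"
  shows "integrable M (\<lambda>\<omega>. Y \<omega> * g (x k \<omega>))"
    and "c2 * (\<alpha> k)\<^sup>2 * (\<integral>\<omega>. Y \<omega> * g (x k \<omega>) \<partial>M) \<le> (\<integral>\<omega>. Y \<omega> * (d k \<omega>)\<^sup>2 \<partial>M)"
proof -
  interpret sub: finite_measure_subalgebra M "F k"
    by standard (rule subalgebra_F)
  have [measurable]: "Y \<in> borel_measurable M"
    by (rule measurable_from_F[OF Y])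
  let ?ce = "real_cond_exp M (F k) (\<lambda>\<omega>. (d k \<omega>)\<^sup>2)"
  have ce: "integrable M (\<lambda>\<omega>. Y \<omega> * ?ce \<omega>)"
    "(\<integral>\<omega>. Y \<omega> * ?ce \<omega> \<partial>M) = (\<integral>\<omega>. Y \<omega> * (d k \<omega>)\<^sup>2 \<partial>M)"
    using sub.real_cond_exp_intg[OF int Y] by auto
  have le: "AE \<omega> in M. c2 * (\<alpha> k)\<^sup>2 * (Y \<omega> * g (x k \<omega>)) \<le> Y \<omega> * ?ce \<omega>"
    using expected_step_lower[of k] AE_space
    by eventually_elim (use nonneg in \<open>auto simp: d_def mult.left_commute intro!: mult_left_mono\<close>)
  have pos: "0 < c2 * (\<alpha> k)\<^sup>2"
    using c2_pos \<alpha>_pos[of k] by simp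
  have "integrable M (\<lambda>\<omega>. c2 * (\<alpha> k)\<^sup>2 * (Y \<omega> * g (x k \<omega>)))"
  proof (rule Bochner_Integration.integrable_bound[OF ce(1)])
    show "AE \<omega> in M. norm (c2 * (\<alpha> k)\<^sup>2 * (Y \<omega> * g (x k \<omega>))) \<le> norm (Y \<omega> * ?ce \<omega>)"
      using le AE_space
    proof eventually_elim
      case (elim \<omega>)
      have "0 \<le> c2 * (\<alpha> k)\<^sup>2 * (Y \<omega> * g (x k \<omega>))"
        using pos nonneg[OF elim(2)] g_x_nonneg[OF elim(2)] by simp
      then show ?case
        using elim(1) by (simp only: real_norm_def)
    qed
  qed measurable
  then show int_g: "integrable M (\<lambda>\<omega>. Y \<omega> * g (x k \<omega>))"
    using c2_pos \<alpha>_pos[of k] by simp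
  have "(\<integral>\<omega>. c2 * (\<alpha> k)\<^sup>2 * (Y \<omega> * g (x k \<omega>)) \<partial>M) \<le> (\<integral>\<omega>. Y \<omega> * ?ce \<omega> \<partial>M)"
    using int_g ce(1) le by (intro integral_mono_AE) auto
  then show "c2 * (\<alpha> k)\<^sup>2 * (\<integral>\<omega>. Y \<omega> * g (x k \<omega>) \<partial>M) \<le> (\<integral>\<omega>. Y \<omega> * (d k \<omega>)\<^sup>2 \<partial>M)"
    using ce(2) by simp
qed

text \<open>Off the zeros of \<open>g\<close>, dividing the weight by
  \<open>c3 * (\<alpha> k)\<^sup>2 * g\<close> turns squared steps into \<open>D k\<close> and
  \<open>c2\<close> into \<open>p\<close>. The zeros are split off into \<open>Z0\<close>; there
  \<open>D k\<close> is \<open>1\<close>, and \<open>p \<le> 1\<close> suffices.\<close>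

lemma expected_D_weighted:
  assumes Z: "Z \<in> borel_measurable (F k)" and bounds: "\<And>\<omega>. \<omega> \<in> space M \<Longrightarrow> 0 \<le> Z \<omega> \<and> Z \<omega> \<le> B"
  shows "p * (\<integral>\<omega>. Z \<omega> \<partial>M) \<le> (\<integral>\<omega>. Z \<omega> * D k \<omega> \<partial>M)"
proof -
  have Zm[measurable]: "Z \<in> borel_measurable M"
    by (rule measurable_from_F[OF Z])
  let ?a = "c3 * (\<alpha> k)\<^sup>2"
  have a: "0 < ?a"
    using c3_pos \<alpha>_pos[of k] by simp
  \<comment> \<open>Division by zero makes \<open>Y\<close> vanish where \<open>g\<close> does, so
    the identities \<open>Yd\<close> and \<open>Yg\<close> hold at every point.\<close>
  define Y where "Y \<omega> = Z \<omega> / (?a * g (x k \<omega>))" for \<omega>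
  define Z0 where "Z0 \<omega> = (if g (x k \<omega>) = 0 then Z \<omega> else 0)" for \<omega>
  have [measurable]: "(\<lambda>\<omega>. g (x k \<omega>)) \<in> borel_measurable (F k)"
    by (rule g_measurable_F) simp
  have Y: "Y \<in> borel_measurable (F k)"
    using Z unfolding Y_def[abs_def] by measurable
  have [measurable]: "Y \<in> borel_measurable M" "Z0 \<in> borel_measurable M"
    unfolding Y_def[abs_def] Z0_def[abs_def] by measurable
  have Yd: "Y \<omega> * (d k \<omega>)\<^sup>2 + Z0 \<omega> = Z \<omega> * D k \<omega>" for \<omega>
    by (simp add: Y_def Z0_def D_def)
  have Yg: "?a * (Y \<omega> * g (x k \<omega>)) + Z0 \<omega> = Z \<omega>" for \<omega>
    using c3_pos \<alpha>_pos[of k] by (simp add: Y_def Z0_def)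
  have Z0: "0 \<le> Z0 \<omega>" "Z0 \<omega> \<le> B" if "\<omega> \<in> space M" for \<omega>
    using bounds[OF that] by (auto simp: Z0_def)
  have iZ0: "integrable M Z0"
    by (rule integrable_bounded[of _ B]) (use Z0 in auto)
  have ZD: "0 \<le> Z \<omega> * D k \<omega>" "Z \<omega> * D k \<omega> \<le> B" if "\<omega> \<in> space M" for \<omega>
    using bounds[OF that] D_nonneg[OF that, of k] D_le_1[OF that, of k] mult_mono[of "Z \<omega>" B "D k \<omega>" 1]
    by auto
  have iZD: "integrable M (\<lambda>\<omega>. Z \<omega> * D k \<omega>)"
    by (rule integrable_bounded[of _ B]) (use ZD in auto)
  have "integrable M (\<lambda>\<omega>. Z \<omega> * D k \<omega> - Z0 \<omega>)"
    using iZD iZ0 by simp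
  then have iYd: "integrable M (\<lambda>\<omega>. Y \<omega> * (d k \<omega>)\<^sup>2)"
    by (simp flip: Yd)
  have Y0: "0 \<le> Y \<omega>" if "\<omega> \<in> space M" for \<omega>
    using bounds[OF that] g_x_nonneg[OF that] a by (simp add: Y_def)
  note st = expected_step_weighted[OF Y Y0 iYd]
  have "p * (\<integral>\<omega>. Z \<omega> \<partial>M) = p * (\<integral>\<omega>. ?a * (Y \<omega> * g (x k \<omega>)) + Z0 \<omega> \<partial>M)"
    by (simp only: Yg)
  also have "\<dots> = c2 * (\<alpha> k)\<^sup>2 * (\<integral>\<omega>. Y \<omega> * g (x k \<omega>) \<partial>M) + p * (\<integral>\<omega>. Z0 \<omega> \<partial>M)"
    using st(1) iZ0 c3_pos by (simp add: p_def distrib_left)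
  also have "\<dots> \<le> (\<integral>\<omega>. Y \<omega> * (d k \<omega>)\<^sup>2 \<partial>M) + 1 * (\<integral>\<omega>. Z0 \<omega> \<partial>M)"
    using st(2) p_le_1 Z0(1) by (intro add_mono mult_right_mono integral_nonneg_AE AE_I2) auto
  also have "\<dots> = (\<integral>\<omega>. Z \<omega> * D k \<omega> \<partial>M)"
    using iYd iZ0 by (simp flip: Yd)
  finally show ?thesis .
qed

text \<open>The optimal Chernoff parameter. With \<open>y / abar\<close> in its place, the moments
  of \<open>W k\<close> decay at rate \<open>p * (1 - exp (- y)) / abar\<close> in
  \<open>A k\<close>, and the threshold \<open>p * A k / 2\<close> costs
  \<open>p * y / (2 * abar)\<close>. The difference \<open>1 - exp (- y) - y / 2\<close> is largest
  at \<open>y = ln 2\<close>, with value \<open>(1 - ln 2) / 2\<close>.\<close>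

definition lam :: real where
  "lam = ln 2 / abar"

lemma lam_pos: "0 < lam"
  using abar_pos by (simp add: lam_def)

text \<open>Convexity of \<open>exp\<close> is used twice: in \<open>D k\<close>, to get a bound
  linear in \<open>D k\<close>, for which the conditional mean suffices, and in
  \<open>\<alpha> k / abar\<close>, to make the gain per step proportional to
  \<open>\<alpha> k\<close>, so that the exponents add up to a multiple of \<open>A k\<close>. The
  factor \<open>1 / 2\<close> is \<open>1 - exp (- ln 2)\<close>.\<close>

lemma laplace_W_le: "(\<integral>\<omega>. exp (- lam * W k \<omega>) \<partial>M) \<le> exp (- (p / (2 * abar)) * A k)"
proof (induction k)
  case 0
  then show ?case
    by (simp add: W_def prob_space)
next
  case (Suc k)
  let ?E = "\<integral>\<omega>. exp (- lam * W k \<omega>) \<partial>M" and ?e = "exp (- lam * \<alpha> k)"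
  have \<alpha>: "0 \<le> \<alpha> k" "0 \<le> \<alpha> k / abar" "\<alpha> k / abar \<le> 1"
    using \<alpha>_pos[of k] \<alpha>_le[of k] abar_pos by auto
  have "?e \<le> 1 - \<alpha> k / abar + \<alpha> k / abar * exp (- ln 2)"
    using exp_chord[OF \<alpha>(2,3), of "- ln 2"] by (simp add: lam_def mult.commute)
  then have e: "\<alpha> k / (2 * abar) \<le> 1 - ?e"
    by (simp add: exp_minus)
  then have e0: "0 \<le> 1 - ?e"
    using \<alpha> abar_pos by (meson divide_nonneg_pos mult_pos_pos order_trans zero_less_numeral)
  have iD: "integrable M (\<lambda>\<omega>. exp (- lam * W k \<omega>) * D k \<omega>)"
    by (rule integrable_bounded[of _ 1])
      (use D_nonneg D_le_1 W_nonneg lam_pos in \<open>auto simp: abs_mult intro!: mult_le_one\<close>)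
  note iW = exp_W_integrable[OF less_imp_le[OF lam_pos], of k]
  have ED: "p * ?E \<le> (\<integral>\<omega>. exp (- lam * W k \<omega>) * D k \<omega> \<partial>M)"
  proof (rule expected_D_weighted[of _ _ 1])
    have [measurable]: "W k \<in> borel_measurable (F k)"
      by (rule W_measurable_F)
    show "(\<lambda>\<omega>. exp (- lam * W k \<omega>)) \<in> borel_measurable (F k)"
      by measurable
  qed (use W_nonneg lam_pos in auto)
  have "(\<integral>\<omega>. exp (- lam * W (Suc k) \<omega>) \<partial>M)
      \<le> (\<integral>\<omega>. exp (- lam * W k \<omega>) - (1 - ?e) * (exp (- lam * W k \<omega>) * D k \<omega>) \<partial>M)"
  proof (rule integral_mono)
    fix \<omega> assume \<omega>: "\<omega> \<in> space M"
    have "exp (- lam * W (Suc k) \<omega>) = exp (- lam * W k \<omega>) * exp (D k \<omega> * (- lam * \<alpha> k))"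
      by (simp add: W_Suc algebra_simps flip: exp_add)
    also have "\<dots> \<le> exp (- lam * W k \<omega>) * (1 - D k \<omega> + D k \<omega> * ?e)"
      by (intro mult_left_mono exp_chord D_nonneg D_le_1 \<omega>) auto
    finally show "exp (- lam * W (Suc k) \<omega>)
        \<le> exp (- lam * W k \<omega>) - (1 - ?e) * (exp (- lam * W k \<omega>) * D k \<omega>)"
      by (simp add: algebra_simps)
  qed (use exp_W_integrable[OF less_imp_le[OF lam_pos], of "Suc k"] iW iD in auto)
  also have "\<dots> = ?E - (1 - ?e) * (\<integral>\<omega>. exp (- lam * W k \<omega>) * D k \<omega> \<partial>M)"
    using iW iD by simp
  also have "\<dots> \<le> ?E - (1 - ?e) * (p * ?E)"
    using ED e0 by (intro diff_left_mono mult_left_mono) auto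
  also have "\<dots> = (1 - p * (1 - ?e)) * ?E"
    by (simp add: algebra_simps)
  also have "\<dots> \<le> exp (- (p / (2 * abar)) * \<alpha> k) * ?E"
  proof (rule mult_right_mono)
    have "1 - p * (1 - ?e) \<le> 1 + - (p / (2 * abar)) * \<alpha> k"
      using mult_left_mono[OF e, of p] p_pos by simp
    also have "\<dots> \<le> exp (- (p / (2 * abar)) * \<alpha> k)"
      by (rule exp_ge_add_one_self)
    finally show "1 - p * (1 - ?e) \<le> exp (- (p / (2 * abar)) * \<alpha> k)" .
  qed (simp add: integral_nonneg_AE)
  also have "\<dots> \<le> exp (- (p / (2 * abar)) * \<alpha> k) * exp (- (p / (2 * abar)) * A k)"
    using Suc by (intro mult_left_mono) auto
  also have "\<dots> = exp (- (p / (2 * abar)) * A (Suc k))"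
    by (simp add: A_Suc algebra_simps add_divide_distrib flip: exp_add)
  finally show ?case .
qed

text \<open>Where \<open>W k\<close> is below \<open>p * A k / 2\<close>, the gap is at most
  \<open>V0\<close> and the exponential factor is at least \<open>1\<close>, as in Markov's
  inequality. Elsewhere inverting \<open>Psi_V_ge\<close> gives the second term.\<close>

lemma expected_V_le:
  "(\<integral>\<omega>. V k \<omega> \<partial>M) \<le> exp (- ((1 - ln 2) / 2) * (c2 / (c3 * abar)) * A k) * V0
    + Psi_inv \<tau> \<phi> t0 (Psi \<phi> t0 V0 + ereal (c1 * c2 / 2 * A k))" (is "_ \<le> ?e * V0 + ?t")
proof -
  let ?s = "lam * p * A k / 2"
  have u: "Psi \<phi> t0 V0 \<le> Psi \<phi> t0 V0 + ereal (c1 * c2 / 2 * A k)"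
    using A_nonneg[of k] c1_pos c2_pos by (simp add: ereal_le_add_self)
  have V0: "0 \<le> V0"
    using V0_domain by (simp add: modulus_domain_def)
  have t: "0 \<le> ?t"
    using Psi_inv_props(1)[OF V0_domain u] by (simp add: modulus_domain_def)
  have "V k \<omega> \<le> V0 * (exp ?s * exp (- lam * W k \<omega>)) + ?t" if \<omega>: "\<omega> \<in> space M" for \<omega>
  proof (cases "W k \<omega> < p * A k / 2")
    case True
    then have "0 \<le> ?s - lam * W k \<omega>"
      using mult_left_mono[of "W k \<omega>" "p * A k / 2" lam] lam_pos by simp
    then have "1 \<le> exp ?s * exp (- lam * W k \<omega>)"
      by (simp flip: exp_add)
    then have "V0 * 1 \<le> V0 * (exp ?s * exp (- lam * W k \<omega>))"
      using V0 by (rule mult_left_mono)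
    then show ?thesis
      using V_le_V0[OF \<omega>, of k] t by linarith
  next
    case False
    have "c1 * c2 / 2 * A k = c1 * c3 * (p * A k / 2)"
      using c3_pos by (simp add: p_def)
    also have "\<dots> \<le> c1 * c3 * W k \<omega>"
      using False c1_pos c3_pos by (intro mult_left_mono) auto
    finally have "Psi \<phi> t0 V0 + ereal (c1 * c2 / 2 * A k) \<le> Psi \<phi> t0 (V k \<omega>)"
      by (intro order_trans[OF add_left_mono Psi_V_ge[OF \<omega>]]) simp
    then have "V k \<omega> \<le> ?t"
      by (intro le_Psi_inv[OF V0_domain u V_domain[OF \<omega>]])
    moreover have "0 \<le> V0 * (exp ?s * exp (- lam * W k \<omega>))"
      using V0 by simp
    ultimately show ?thesis
      by linarith
  qed
  then have "(\<integral>\<omega>. V k \<omega> \<partial>M) \<le> (\<integral>\<omega>. V0 * (exp ?s * exp (- lam * W k \<omega>)) + ?t \<partial>M)"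
    using exp_W_integrable[OF less_imp_le[OF lam_pos], of k]
    by (intro integral_mono V_integrable) auto
  also have "\<dots> = V0 * (exp ?s * (\<integral>\<omega>. exp (- lam * W k \<omega>) \<partial>M)) + ?t"
    using exp_W_integrable[OF less_imp_le[OF lam_pos], of k] by (simp add: prob_space)
  also have "\<dots> \<le> V0 * (exp ?s * exp (- (p / (2 * abar)) * A k)) + ?t"
    using laplace_W_le[of k] V0 by (intro add_right_mono mult_left_mono) auto
  also have "exp ?s * exp (- (p / (2 * abar)) * A k) = ?e"
    using abar_pos c3_pos by (simp add: lam_def p_def field_simps flip: exp_add)
  finally show ?thesis
    by (simp add: mult.commute)
qed

text \<open>The exponential moment bound has slack, because \<open>ln 2 < 1\<close>. It is spent on making
  \<open>\<Sum>k. \<alpha> k * exp (r * A k - lam * W k)\<close> integrable, for a rate \<open>r > lam * p / 2\<close>. The terms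
  of a convergent series of this kind stay bounded even without the factor \<open>\<alpha> k\<close>, because
  their increments are controlled by the series.\<close>

lemma AE_W_growth: "AE \<omega> in M. \<forall>\<^sub>F k in sequentially. p / 2 * A k + R \<le> W k \<omega>"
proof -
  \<comment> \<open>\<open>r\<close> is the midpoint of \<open>lam * p / 2\<close> and the rate
    \<open>p / (2 * abar)\<close> of the moment bound. Both halves have length
    \<open>\<delta>\<close>: one makes the means of \<open>N\<close> decay, the other gives
    \<open>W\<close> a surplus linear in \<open>A k\<close>, which outgrows the constant
    \<open>R\<close>.\<close>
  define r where "r = p * (1 + ln 2) / (4 * abar)"
  define \<delta> where "\<delta> = p * (1 - ln 2) / (4 * abar)"
  define N where "N k \<omega> = exp (r * A k) * exp (- lam * W k \<omega>)" for k \<omega>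
  have ln2: "ln 2 < (1 :: real)"
    using ln_2_less_1 .
  have pos: "0 < r" "0 < \<delta>"
    using p_pos abar_pos ln2 by (auto simp: r_def \<delta>_def add_pos_pos)
  have iN: "integrable M (N k)" for k
    unfolding N_def[abs_def] using exp_W_integrable[OF less_imp_le[OF lam_pos], of k] by simp
  have EN: "(\<integral>\<omega>. N k \<omega> \<partial>M) \<le> exp (- \<delta> * A k)" for k
  proof -
    have "(\<integral>\<omega>. N k \<omega> \<partial>M) \<le> exp (r * A k) * exp (- (p / (2 * abar)) * A k)"
      unfolding N_def using laplace_W_le[of k] by simp
    also have "\<dots> = exp (- \<delta> * A k)"
      using abar_pos by (simp add: r_def \<delta>_def field_simps flip: exp_add)
    finally show ?thesis .
  qed
  have "AE \<omega> in M. summable (\<lambda>k. \<alpha> k * N k \<omega>)"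
  proof (rule AE_summable_if_sum_integral_le)
    show "integrable M (\<lambda>\<omega>. \<alpha> k * N k \<omega>)" for k
      using iN by simp
    show "0 \<le> \<alpha> k * N k \<omega>" for k \<omega>
      using \<alpha>_pos[of k] by (simp add: N_def)
    have "(\<Sum>k<n. \<integral>\<omega>. \<alpha> k * N k \<omega> \<partial>M) \<le> (\<Sum>k<n. \<alpha> k * exp (- \<delta> * A k))" for n
      using EN \<alpha>_pos iN by (intro sum_mono) (auto intro!: mult_left_mono simp: less_imp_le)
    then show "(\<Sum>k<n. \<integral>\<omega>. \<alpha> k * N k \<omega> \<partial>M) \<le> (1 + \<delta> * abar) / \<delta>" for n
      using sum_weighted_exp_le[OF \<alpha>_pos \<alpha>_le pos(2)] unfolding A_def by (rule order_trans)
  qed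
  then show ?thesis
    using AE_space
  proof eventually_elim
    case (elim \<omega>)
    define C where "C = r * exp (r * abar)"
    have C: "0 < C"
      using pos by (simp add: C_def)
    have N_pos: "0 < N k \<omega>" for k
      by (simp add: N_def)
    have incr: "N (Suc k) \<omega> \<le> N k \<omega> + C * (\<alpha> k * N k \<omega>)" for k
    proof -
      have "exp (r * \<alpha> k) - 1 = exp (r * \<alpha> k) * (1 - exp (- (r * \<alpha> k)))"
        by (simp add: algebra_simps flip: exp_add)
      also have "\<dots> \<le> exp (r * abar) * (r * \<alpha> k)"
        using exp_ge_add_one_self[of "- (r * \<alpha> k)"] \<alpha>_pos[of k] \<alpha>_le[of k] pos
        by (intro mult_mono) auto
      finally have e: "exp (r * \<alpha> k) \<le> 1 + C * \<alpha> k"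
        by (simp add: C_def mult_ac)
      have "N (Suc k) \<omega> = N k \<omega> * exp (r * \<alpha> k) * exp (- lam * (\<alpha> k * D k \<omega>))"
        by (simp add: N_def A_Suc W_Suc algebra_simps flip: exp_add)
      also have "\<dots> \<le> N k \<omega> * exp (r * \<alpha> k) * 1"
        using D_nonneg[OF elim(2), of k] \<alpha>_pos[of k] lam_pos N_pos[of k]
        by (intro mult_left_mono) auto
      also have "\<dots> \<le> N k \<omega> * (1 + C * \<alpha> k)"
        using e N_pos[of k] by simp
      finally show ?thesis
        by (simp add: algebra_simps)
    qed
    have N_sum: "N n \<omega> \<le> 1 + C * (\<Sum>k<n. \<alpha> k * N k \<omega>)" for n
    proof (induction n)
      case 0
      then show ?case
        by (simp add: N_def W_def)
    next
      case (Suc n)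
      then show ?case
        using incr[of n] by (simp add: algebra_simps)
    qed
    define B where "B = 1 + C * (\<Sum>k. \<alpha> k * N k \<omega>)"
    have N_le: "N n \<omega> \<le> B" for n
    proof -
      have "(\<Sum>k<n. \<alpha> k * N k \<omega>) \<le> (\<Sum>k. \<alpha> k * N k \<omega>)"
        using elim(1) \<alpha>_pos N_pos by (intro sum_le_suminf) (auto simp: less_imp_le)
      then show ?thesis
        using N_sum[of n] mult_left_mono[OF _ less_imp_le[OF C]] unfolding B_def by fastforce
    qed
    have W_ge: "r * A n - ln B \<le> lam * W n \<omega>" for n
    proof -
      have "ln (N n \<omega>) \<le> ln B"
        using N_le[of n] N_pos[of n] by simp
      then show ?thesis
        by (simp add: N_def flip: exp_add)
    qed
    have "0 < r - lam * p / 2"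
      using p_pos abar_pos ln2 by (simp add: r_def lam_def field_simps)
    then have "filterlim (\<lambda>k. (r - lam * p / 2) * A k) at_top sequentially"
      by (rule scaled_A_at_top)
    then have "\<forall>\<^sub>F k in sequentially. lam * R + ln B \<le> (r - lam * p / 2) * A k"
      by (simp add: filterlim_at_top)
    then show ?case
    proof eventually_elim
      case (elim k)
      have "lam * (p / 2 * A k + R) = lam * p / 2 * A k + lam * R"
        by (simp add: algebra_simps)
      also have "\<dots> \<le> r * A k - ln B"
        using elim by (simp add: algebra_simps)
      also have "\<dots> \<le> lam * W k \<omega>"
        by (rule W_ge)
      finally show ?case
        using lam_pos by simp
    qed
  qed
qed

section \<open>The almost sure rate and convergence of the gap to zero\<close>

definition rate :: "nat \<Rightarrow> real" where
  "rate k = Psi_inv \<tau> \<phi> t0 (ereal (c1 * c2 / 2 * A k))"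

lemma t0_domain: "t0 \<in> modulus_domain \<tau>"
  using t0_pos t0_less by (simp add: modulus_domain_def)

text \<open>\<open>Psi\<close> vanishes at \<open>t0\<close>, so every nonnegative argument lies in
  its range.\<close>

lemma rate_arg: "Psi \<phi> t0 t0 \<le> ereal (c1 * c2 / 2 * A k)"
  using Psi_eq[OF t0_pos t0_less] A_nonneg[of k] c1_pos c2_pos by (simp add: psi_t0)

lemma rate_domain: "rate k \<in> modulus_domain \<tau>"
  unfolding rate_def by (rule Psi_inv_props(1)[OF t0_domain rate_arg])

lemma Psi_rate: "Psi \<phi> t0 (rate k) = ereal (c1 * c2 / 2 * A k)"
  unfolding rate_def by (rule Psi_inv_props(3)[OF t0_domain rate_arg])

lemma rate_pos: "0 < rate k" and rate_less_\<tau>: "ereal (rate k) < \<tau>"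
proof -
  have "rate k \<noteq> 0"
    using Psi_rate[of k] Psi_0 by auto
  then show "0 < rate k" "ereal (rate k) < \<tau>"
    using rate_domain[of k] by (auto simp: modulus_domain_def)
qed

lemma psi_rate: "psi (rate k) = c1 * c2 / 2 * A k"
  using Psi_rate[of k] Psi_eq[OF rate_pos rate_less_\<tau>, of k] by simp

lemma rate_Suc_le: "rate (Suc k) \<le> rate k"
proof (rule ccontr)
  assume "\<not> ?thesis"
  then have "c1 * c2 / 2 * A (Suc k) < c1 * c2 / 2 * A k"
    using psi_less[OF rate_pos _ rate_less_\<tau>, of k "Suc k"] by (simp add: psi_rate)
  then show False
    using c1_pos c2_pos \<alpha>_pos[of k] by (simp add: A_Suc)
qed

text \<open>Gaining one step in the index is what makes the discrete sums comparable with the integral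
  defining \<open>Phi\<close> later.\<close>

lemma AE_eventually_V_le_rate: "AE \<omega> in M. \<forall>\<^sub>F k in sequentially. V k \<omega> \<le> rate (Suc k)"
proof -
  \<comment> \<open>\<open>Psi\<close> at \<open>V0\<close> is infinite if \<open>V0 = 0\<close> and
    may be negative if \<open>V0\<close> exceeds \<open>t0\<close>; \<open>q\<close> is a real lower
    bound in every case.\<close>
  obtain q where q: "ereal q \<le> Psi \<phi> t0 V0"
    using V0_domain
  proof (cases rule: modulus_domain_cases)
    case 1
    then show ?thesis
      using that[of 0] Psi_0 by simp
  next
    case 2
    then show ?thesis
      using that[of "psi V0"] Psi_eq by simp
  qed
  \<comment> \<open>\<open>R\<close> pays for a negative \<open>q\<close> and for the one extra
    stepsize, at most \<open>abar\<close>. This is why the almost sure rate carries no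
    \<open>Psi\<close> of the initial gap.\<close>
  define R where "R = (c1 * c2 / 2 * abar - q) / (c1 * c3)"
  have c: "0 < c1 * c3"
    using c1_pos c3_pos by simp
  show ?thesis
    using AE_W_growth[of R] AE_space
  proof eventually_elim
    case (elim \<omega>)
    from elim(1) show ?case
    proof eventually_elim
      case (elim k)
      have "c1 * c2 / 2 * A (Suc k) \<le> c1 * c2 / 2 * (A k + abar)"
        using c1_pos c2_pos \<alpha>_le[of k] by (simp add: A_Suc)
      also have "\<dots> = q + c1 * c3 * (p / 2 * A k + R)"
        using c c3_pos c1_pos by (simp add: R_def p_def field_simps)
      also have "\<dots> \<le> q + c1 * c3 * W k \<omega>"
        using mult_left_mono[OF elim, of "c1 * c3"] c by simp
      finally have "ereal (c1 * c2 / 2 * A (Suc k)) \<le> ereal q + ereal (c1 * c3 * W k \<omega>)"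
        by simp
      also have "\<dots> \<le> Psi \<phi> t0 V0 + ereal (c1 * c3 * W k \<omega>)"
        using q by (rule add_right_mono)
      also have "\<dots> \<le> Psi \<phi> t0 (V k \<omega>)"
        using Psi_V_ge \<open>\<omega> \<in> space M\<close> .
      finally show ?case
        unfolding rate_def using \<open>\<omega> \<in> space M\<close>
        by (intro le_Psi_inv[OF t0_domain rate_arg V_domain])
    qed
  qed
qed

lemma expected_V_tendsto_0: "(\<lambda>k. \<integral>\<omega>. V k \<omega> \<partial>M) \<longlonglongrightarrow> 0"
proof (rule tendsto_sandwich[OF _ _ tendsto_const])
  let ?c = "(1 - ln 2) / 2 * (c2 / (c3 * abar))"
  let ?u = "\<lambda>k. Psi \<phi> t0 V0 + ereal (c1 * c2 / 2 * A k)"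
  show "\<forall>\<^sub>F k in sequentially. 0 \<le> (\<integral>\<omega>. V k \<omega> \<partial>M)"
    using V_nonneg by (intro always_eventually allI integral_nonneg_AE AE_I2)
  show "\<forall>\<^sub>F k in sequentially.
      (\<integral>\<omega>. V k \<omega> \<partial>M) \<le> exp (- (?c * A k)) * V0 + Psi_inv \<tau> \<phi> t0 (?u k)"
    using expected_V_le by (intro always_eventually allI) simp
  have "0 < ?c"
    using ln_2_less_1 c2_pos c3_pos abar_pos by simp
  then have "filterlim (\<lambda>k. ?c * A k) at_top sequentially"
    by (rule scaled_A_at_top)
  then have e: "(\<lambda>k. exp (- (?c * A k))) \<longlonglongrightarrow> 0"
    by (intro filterlim_compose[OF exp_at_bot] filterlim_compose[OF filterlim_uminus_at_bot_at_top])
  have "?u \<longlonglongrightarrow> \<infinity>"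
    using V0_domain
  proof (cases rule: modulus_domain_cases)
    case 1
    then show ?thesis
      by (simp add: Psi_0)
  next
    case 2
    then have "(\<lambda>k. Psi \<phi> t0 V0 + ereal (c1 * c2 / 2 * A k)) \<longlonglongrightarrow> Psi \<phi> t0 V0 + \<infinity>"
      by (intro tendsto_add_ereal_general A_tendsto_PInf tendsto_const) (auto simp: Psi_eq)
    then show ?thesis
      using 2 by (simp add: Psi_eq)
  qed
  then have "(\<lambda>k. Psi_inv \<tau> \<phi> t0 (?u k)) \<longlonglongrightarrow> 0"
    using A_nonneg c1_pos c2_pos
    by (intro Psi_inv_tendsto_0[OF V0_domain]) (simp_all add: ereal_le_add_self)
  then have "(\<lambda>k. exp (- (?c * A k)) * V0 + Psi_inv \<tau> \<phi> t0 (?u k)) \<longlonglongrightarrow> 0 * V0 + 0"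
    by (intro tendsto_add tendsto_mult_right e)
  then show "(\<lambda>k. exp (- (?c * A k)) * V0 + Psi_inv \<tau> \<phi> t0 (?u k)) \<longlonglongrightarrow> 0"
    by simp
qed

lemma AE_V_tendsto_0: "AE \<omega> in M. (\<lambda>k. V k \<omega>) \<longlonglongrightarrow> 0"
proof -
  have "rate \<longlonglongrightarrow> 0"
    unfolding rate_def[abs_def] by (intro Psi_inv_tendsto_0[OF t0_domain rate_arg A_tendsto_PInf])
  then have lim: "(\<lambda>k. rate (Suc k)) \<longlonglongrightarrow> 0"
    by (rule LIMSEQ_Suc)
  show ?thesis
    using AE_eventually_V_le_rate AE_space
  proof eventually_elim
    case (elim \<omega>)
    then show ?case
      using V_nonneg by (intro tendsto_sandwich[OF _ elim(1) tendsto_const lim]) simp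
  qed
qed

end

section \<open>Sequences with summable steps\<close>

lemma
  fixes X :: "nat \<Rightarrow> 'b::banach"
  assumes summ: "summable (\<lambda>i. norm (X (Suc i) - X i))"
  shows tendsto_lim_if_summable_steps: "X \<longlonglongrightarrow> lim X"
    and dist_lim_le_suminf_steps: "norm (X k - lim X) \<le> (\<Sum>i. norm (X (Suc (k + i)) - X (k + i)))"
proof -
  have "(\<lambda>n. X 0 + (\<Sum>i<n. X (Suc i) - X i)) \<longlonglongrightarrow> X 0 + (\<Sum>i. X (Suc i) - X i)"
    by (intro tendsto_add tendsto_const summable_LIMSEQ summable_norm_cancel[OF summ])
  then show lim: "X \<longlonglongrightarrow> lim X"
    by (simp add: sum_lessThan_telescope convergent_LIMSEQ_iff[symmetric] convergentI)
  have summ': "summable (\<lambda>i. norm (X (Suc (k + i)) - X (k + i)))"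
    using summable_ignore_initial_segment[OF summ, of k] by (simp add: add.commute)
  have "norm (X (n + k) - X k) \<le> (\<Sum>i. norm (X (Suc (k + i)) - X (k + i)))" for n
  proof -
    have "X (n + k) - X k = (\<Sum>i<n. X (Suc (k + i)) - X (k + i))"
      using sum_lessThan_telescope[of "\<lambda>i. X (k + i)" n] by (simp add: add.commute)
    also have "norm \<dots> \<le> (\<Sum>i<n. norm (X (Suc (k + i)) - X (k + i)))"
      by (rule norm_sum)
    also have "\<dots> \<le> (\<Sum>i. norm (X (Suc (k + i)) - X (k + i)))"
      by (intro sum_le_suminf summ') auto
    finally show ?thesis .
  qed
  then have "norm (lim X - X k) \<le> (\<Sum>i. norm (X (Suc (k + i)) - X (k + i)))"
    by (intro LIMSEQ_le_const2[OF tendsto_norm[OF tendsto_diff[OF LIMSEQ_ignore_initial_segment[OF lim]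
      tendsto_const]]]) auto
  then show "norm (X k - lim X) \<le> (\<Sum>i. norm (X (Suc (k + i)) - X (k + i)))"
    by (simp add: norm_minus_commute)
qed

subsection \<open>Convergence of the iterates\<close>

locale mra_sqrt_error_bound =
  mra_error_bound M F x x0 S g h c1 c2 c3 \<alpha> \<tau> \<phi> t0 abar + sqrt_integrable_modulus \<tau> \<phi> t0
  for M :: "'a measure" and F and x :: "nat \<Rightarrow> 'a \<Rightarrow> real ^ 'd" and x0 S g h c1 c2 c3 \<alpha> \<tau> \<phi> t0 abar
begin

lemma Phi_V_Suc_le: "\<omega> \<in> space M \<Longrightarrow> Phi \<phi> (V (Suc k) \<omega>) \<le> Phi \<phi> (V k \<omega>)"
  by (intro Phi_mono V_nonneg V_Suc_le V_less_\<tau>)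

lemma Phi_V_nonneg: "\<omega> \<in> space M \<Longrightarrow> 0 \<le> Phi \<phi> (V k \<omega>)"
  by (intro Phi_nonneg V_nonneg V_less_\<tau>)

lemma V0_less_\<tau>: "ereal V0 < \<tau>"
  using V0_domain by (simp add: modulus_domain_def)

lemma Phi_V_measurable [measurable]: "(\<lambda>\<omega>. Phi \<phi> (V k \<omega>)) \<in> borel_measurable M"
proof -
  have "(\<lambda>v. indicator {0..V0} v *\<^sub>R Phi \<phi> v) \<in> borel_measurable borel"
    by (intro borel_measurable_continuous_on_indicator Phi_continuous V0_less_\<tau>) auto
  from measurable_compose[OF V_measurable this, of k]
  show ?thesis
    by (rule iffD1[OF measurable_cong, rotated]) (use V_nonneg V_le_V0 in auto)
qed

lemma Phi_V_integrable: "integrable M (\<lambda>\<omega>. Phi \<phi> (V k \<omega>))"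
  by (rule integrable_bounded[of _ "Phi \<phi> V0"])
    (use Phi_V_nonneg in \<open>auto intro!: Phi_mono V_nonneg V_le_V0 V0_less_\<tau>\<close>)

text \<open>Shared by both convergence arguments: in expectation \<open>r\<close> is
  \<open>g (x k \<omega>)\<close>, along a path it is \<open>\<phi>\<close> at the almost sure rate.
  At a positive gap, sufficient decrease is combined with the concavity of \<open>Phi\<close>; at
  gap \<open>0\<close> the step is zero.\<close>

lemma weighted_d_sq_le_Phi_diff:
  assumes \<omega>: "\<omega> \<in> space M" and r: "0 < \<phi> (V k \<omega>) \<Longrightarrow> \<phi> (V k \<omega>) \<le> r"
  shows "(d k \<omega>)\<^sup>2 / sqrt r \<le> \<alpha> k / c1 * (Phi \<phi> (V k \<omega>) - Phi \<phi> (V (Suc k) \<omega>))"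
proof (cases "V k \<omega> = 0")
  case True
  then have "V (Suc k) \<omega> = 0"
    using V_nonneg[OF \<omega>, of "Suc k"] V_Suc_le[OF \<omega>, of k] by simp
  then show ?thesis
    using d_sq_le[OF \<omega>, of k] True by simp
next
  case False
  let ?v = "V k \<omega>" and ?v' = "V (Suc k) \<omega>"
  have v: "0 < ?v" "ereal ?v < \<tau>"
    using False V_nonneg[OF \<omega>, of k] V_less_\<tau>[OF \<omega>] by auto
  then have \<phi>: "0 < \<phi> ?v" "\<phi> ?v \<le> r"
    using \<phi>_gt_0 r by auto
  have "(d k \<omega>)\<^sup>2 / sqrt r \<le> (d k \<omega>)\<^sup>2 / sqrt (\<phi> ?v)"
    using \<phi> by (intro divide_left_mono) auto
  also have "\<dots> \<le> \<alpha> k / c1 * (?v - ?v') / sqrt (\<phi> ?v)"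
    using \<phi> by (intro divide_right_mono d_sq_le \<omega>) auto
  also have "\<dots> = \<alpha> k / c1 * ((?v - ?v') / sqrt (\<phi> ?v))"
    by simp
  also have "\<dots> \<le> \<alpha> k / c1 * (Phi \<phi> ?v - Phi \<phi> ?v')"
    using c1_pos \<alpha>_pos[of k] v V_nonneg[OF \<omega>] V_Suc_le[OF \<omega>]
    by (intro mult_left_mono Phi_increment_lower) auto
  finally show ?thesis .
qed

lemma d_nonneg: "0 \<le> d k \<omega>"
  by (simp add: d_def)

text \<open>The step is at most a multiple of \<open>sqrt g\<close>, which is \<open>g\<close> with
  the weight \<open>1 / sqrt g\<close>. Testing the conditional bound with this weight leads back to
  \<open>(d k)\<^sup>2 / sqrt g\<close>, which the drop of \<open>Phi\<close> dominates. The two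
  step bounds contribute the factor \<open>sqrt c3 / c2\<close>.\<close>

lemma
  shows d_integrable: "integrable M (d k)"
    and expected_d_le: "(\<integral>\<omega>. d k \<omega> \<partial>M) \<le> sqrt c3 / (c1 * c2) *
      ((\<integral>\<omega>. Phi \<phi> (V k \<omega>) \<partial>M) - (\<integral>\<omega>. Phi \<phi> (V (Suc k) \<omega>) \<partial>M))"
proof -
  define Y where "Y \<omega> = 1 / sqrt (g (x k \<omega>))" for \<omega>
  have [measurable]: "(\<lambda>\<omega>. g (x k \<omega>)) \<in> borel_measurable (F k)"
    by (rule g_measurable_F) simp
  have Y: "Y \<in> borel_measurable (F k)"
    unfolding Y_def[abs_def] by measurable
  have [measurable]: "Y \<in> borel_measurable M"
    by (rule measurable_from_F[OF Y])
  have Y0: "0 \<le> Y \<omega>" if "\<omega> \<in> space M" for \<omega>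
    using g_x_nonneg[OF that] by (simp add: Y_def)
  have Yg: "Y \<omega> * g (x k \<omega>) = sqrt (g (x k \<omega>))" if "\<omega> \<in> space M" for \<omega>
    using g_x_nonneg[OF that, of k] by (simp add: Y_def real_div_sqrt)
  let ?P = "\<lambda>\<omega>. \<alpha> k / c1 * (Phi \<phi> (V k \<omega>) - Phi \<phi> (V (Suc k) \<omega>))"
  have Yd: "Y \<omega> * (d k \<omega>)\<^sup>2 \<le> ?P \<omega>" if "\<omega> \<in> space M" for \<omega>
    using weighted_d_sq_le_Phi_diff[OF that, of k "g (x k \<omega>)"] \<phi>_V_le_g[OF that, of k]
    by (simp add: Y_def)
  have iP: "integrable M ?P"
    using Phi_V_integrable by simp
  have iYd: "integrable M (\<lambda>\<omega>. Y \<omega> * (d k \<omega>)\<^sup>2)"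
  proof (rule Bochner_Integration.integrable_bound[OF iP])
    show "AE \<omega> in M. norm (Y \<omega> * (d k \<omega>)\<^sup>2) \<le> norm (?P \<omega>)"
    proof (rule AE_I2)
      fix \<omega> assume \<omega>: "\<omega> \<in> space M"
      have "0 \<le> Y \<omega> * (d k \<omega>)\<^sup>2"
        using Y0[OF \<omega>] by simp
      then show "norm (Y \<omega> * (d k \<omega>)\<^sup>2) \<le> norm (?P \<omega>)"
        using Yd[OF \<omega>] by (simp only: real_norm_def)
    qed
  qed measurable
  note st = expected_step_weighted[OF Y Y0 iYd]
  have sqrt_eq: "(\<integral>\<omega>. Y \<omega> * g (x k \<omega>) \<partial>M) = (\<integral>\<omega>. sqrt (g (x k \<omega>)) \<partial>M)"
    by (intro Bochner_Integration.integral_cong) (auto simp: Yg)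
  have isqrt: "integrable M (\<lambda>\<omega>. sqrt (g (x k \<omega>)))"
    by (rule iffD1[OF Bochner_Integration.integrable_cong[OF refl Yg] st(1)])
  have d_le: "d k \<omega> \<le> sqrt c3 * \<alpha> k * sqrt (g (x k \<omega>))" if "\<omega> \<in> space M" for \<omega>
  proof -
    have "d k \<omega> = sqrt ((d k \<omega>)\<^sup>2)"
      using d_nonneg by simp
    also have "\<dots> \<le> sqrt (c3 * (\<alpha> k)\<^sup>2 * g (x k \<omega>))"
      by (rule real_sqrt_le_mono[OF d_sq_le_g[OF that]])
    finally show ?thesis
      using \<alpha>_pos[of k] by (simp add: real_sqrt_mult)
  qed
  show id: "integrable M (d k)"
    by (rule Bochner_Integration.integrable_bound[of M "\<lambda>\<omega>. sqrt c3 * \<alpha> k * sqrt (g (x k \<omega>))"])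
      (use isqrt d_nonneg in \<open>auto intro!: AE_I2 order_trans[OF d_le]\<close>)
  have \<alpha>: "0 < \<alpha> k"
    by (rule \<alpha>_pos)
  have "(\<integral>\<omega>. d k \<omega> \<partial>M) \<le> (\<integral>\<omega>. sqrt c3 * \<alpha> k * sqrt (g (x k \<omega>)) \<partial>M)"
    using isqrt by (intro integral_mono id d_le) auto
  also have "\<dots> = sqrt c3 / (c2 * \<alpha> k) * (c2 * (\<alpha> k)\<^sup>2 * (\<integral>\<omega>. sqrt (g (x k \<omega>)) \<partial>M))"
    using \<alpha> c2_pos by (simp add: power2_eq_square)
  also have "\<dots> \<le> sqrt c3 / (c2 * \<alpha> k) * (\<integral>\<omega>. ?P \<omega> \<partial>M)"
  proof (rule mult_left_mono)
    have "c2 * (\<alpha> k)\<^sup>2 * (\<integral>\<omega>. sqrt (g (x k \<omega>)) \<partial>M) \<le> (\<integral>\<omega>. Y \<omega> * (d k \<omega>)\<^sup>2 \<partial>M)"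
      using st(2) by (simp only: sqrt_eq)
    also have "\<dots> \<le> (\<integral>\<omega>. ?P \<omega> \<partial>M)"
      by (intro integral_mono iYd iP Yd)
    finally show "c2 * (\<alpha> k)\<^sup>2 * (\<integral>\<omega>. sqrt (g (x k \<omega>)) \<partial>M) \<le> (\<integral>\<omega>. ?P \<omega> \<partial>M)" .
  qed (use c3_pos c2_pos \<alpha> in auto)
  also have "(\<integral>\<omega>. ?P \<omega> \<partial>M) =
      \<alpha> k / c1 * ((\<integral>\<omega>. Phi \<phi> (V k \<omega>) \<partial>M) - (\<integral>\<omega>. Phi \<phi> (V (Suc k) \<omega>) \<partial>M))"
    using Phi_V_integrable by simp
  finally show "(\<integral>\<omega>. d k \<omega> \<partial>M) \<le> sqrt c3 / (c1 * c2) *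
      ((\<integral>\<omega>. Phi \<phi> (V k \<omega>) \<partial>M) - (\<integral>\<omega>. Phi \<phi> (V (Suc k) \<omega>) \<partial>M))"
    using \<alpha> by (simp add: mult.commute)
qed

lemma expected_V_domain: "(\<integral>\<omega>. V k \<omega> \<partial>M) \<in> modulus_domain \<tau>"
proof -
  have "(\<integral>\<omega>. V k \<omega> \<partial>M) \<le> (\<integral>\<omega>. V0 \<partial>M)"
    by (intro integral_mono V_integrable V_le_V0) auto
  then have "(\<integral>\<omega>. V k \<omega> \<partial>M) \<le> V0"
    by (simp add: prob_space)
  moreover have "0 \<le> (\<integral>\<omega>. V k \<omega> \<partial>M)"
    using V_nonneg by (intro integral_nonneg_AE AE_I2)
  ultimately show ?thesis
    using less_\<tau>[OF _ V0_less_\<tau>] by (simp add: modulus_domain_def)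
qed

text \<open>Taking expectations in the tangent bound at the mean. At mean \<open>0\<close> there is
  no tangent, but then the gap vanishes almost surely.\<close>

lemma Jensen_Phi: "(\<integral>\<omega>. Phi \<phi> (V k \<omega>) \<partial>M) \<le> Phi \<phi> (\<integral>\<omega>. V k \<omega> \<partial>M)"
  using expected_V_domain[of k]
proof (cases rule: modulus_domain_cases)
  case 1
  then have "AE \<omega> in M. V k \<omega> = 0"
    using integral_nonneg_eq_0_iff_AE[OF V_integrable] V_nonneg by simp
  then have "AE \<omega> in M. Phi \<phi> (V k \<omega>) = 0"
    by eventually_elim (simp add: Phi_0)
  then have "(\<integral>\<omega>. Phi \<phi> (V k \<omega>) \<partial>M) = 0"
    by (rule integral_eq_zero_AE)
  then show ?thesis
    using 1 Phi_0 by simp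
next
  case 2
  let ?m = "\<integral>\<omega>. V k \<omega> \<partial>M"
  have "(\<integral>\<omega>. Phi \<phi> (V k \<omega>) \<partial>M) \<le> (\<integral>\<omega>. Phi \<phi> ?m + (V k \<omega> - ?m) / sqrt (\<phi> ?m) \<partial>M)"
    using V_integrable 2
    by (intro integral_mono Phi_V_integrable Phi_tangent V_nonneg V_less_\<tau>) auto
  also have "\<dots> = Phi \<phi> ?m"
    using V_integrable by (simp add: prob_space)
  finally show ?thesis .
qed

lemma sum_expected_d_le:
  "(\<Sum>i<n. \<integral>\<omega>. d (k + i) \<omega> \<partial>M) \<le> sqrt c3 / (c1 * c2) * Phi \<phi> (\<integral>\<omega>. V k \<omega> \<partial>M)"
proof -
  let ?E = "\<lambda>i. \<integral>\<omega>. Phi \<phi> (V (k + i) \<omega>) \<partial>M"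
  have "(\<Sum>i<n. \<integral>\<omega>. d (k + i) \<omega> \<partial>M) \<le> (\<Sum>i<n. sqrt c3 / (c1 * c2) * (?E i - ?E (Suc i)))"
    using expected_d_le by (intro sum_mono) simp
  also have "\<dots> = sqrt c3 / (c1 * c2) * (?E 0 - ?E n)"
    by (subst sum_lessThan_telescope'[symmetric]) (simp add: sum_distrib_left)
  also have "\<dots> \<le> sqrt c3 / (c1 * c2) * Phi \<phi> (\<integral>\<omega>. V k \<omega> \<partial>M)"
  proof (rule mult_left_mono)
    have "0 \<le> ?E n"
      by (intro integral_nonneg_AE AE_I2 Phi_V_nonneg)
    then show "?E 0 - ?E n \<le> Phi \<phi> (\<integral>\<omega>. V k \<omega> \<partial>M)"
      using Jensen_Phi[of k] by simp
  qed (use c1_pos c2_pos c3_pos in auto)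
  finally show ?thesis .
qed

section \<open>The limit of the iterates\<close>

lemma AE_summable_d: "AE \<omega> in M. summable (\<lambda>i. d i \<omega>)"
  using AE_summable_if_sum_integral_le[OF d_integrable d_nonneg sum_expected_d_le[of 0]] by simp

text \<open>On divergent paths \<open>lim\<close> has one fixed value, so measurability needs no
  modification on a null set.\<close>

definition xlim :: "'a \<Rightarrow> real ^ 'd" where
  "xlim \<omega> = lim (\<lambda>k. x k \<omega>)"

lemma xlim_measurable [measurable]: "xlim \<in> borel_measurable M"
  unfolding xlim_def[abs_def] by measurable

lemma tendsto_xlim: "summable (\<lambda>i. d i \<omega>) \<Longrightarrow> (\<lambda>k. x k \<omega>) \<longlonglongrightarrow> xlim \<omega>"
  unfolding d_def xlim_def by (rule tendsto_lim_if_summable_steps)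

lemma dist_xlim_le: "summable (\<lambda>i. d i \<omega>) \<Longrightarrow> norm (x k \<omega> - xlim \<omega>) \<le> (\<Sum>i. d (k + i) \<omega>)"
  unfolding d_def xlim_def by (rule dist_lim_le_suminf_steps)

lemma AE_tendsto_xlim: "AE \<omega> in M. (\<lambda>k. x k \<omega>) \<longlonglongrightarrow> xlim \<omega>"
  using AE_summable_d by eventually_elim (rule tendsto_xlim)

lemma
  shows dist_xlim_integrable: "integrable M (\<lambda>\<omega>. x k \<omega> - xlim \<omega>)"
    and expected_dist_xlim_le: "(\<integral>\<omega>. norm (x k \<omega> - xlim \<omega>) \<partial>M)
      \<le> sqrt c3 / (c1 * c2) * Phi \<phi> (\<integral>\<omega>. V k \<omega> \<partial>M)"
proof -
  have int: "integrable M (\<lambda>\<omega>. \<Sum>i. d (k + i) \<omega>)"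
    by (rule integrable_suminf_if_sum_integral_le[OF d_integrable d_nonneg sum_expected_d_le])
  have le: "AE \<omega> in M. norm (x k \<omega> - xlim \<omega>) \<le> (\<Sum>i. d (k + i) \<omega>)"
    using AE_summable_d by eventually_elim (rule dist_xlim_le)
  show "integrable M (\<lambda>\<omega>. x k \<omega> - xlim \<omega>)"
    by (rule Bochner_Integration.integrable_bound[OF int])
      (use le in \<open>auto elim!: eventually_mono\<close>)
  then have "(\<integral>\<omega>. norm (x k \<omega> - xlim \<omega>) \<partial>M) \<le> (\<integral>\<omega>. (\<Sum>i. d (k + i) \<omega>) \<partial>M)"
    using int le by (intro integral_mono_AE) auto
  also have "\<dots> \<le> sqrt c3 / (c1 * c2) * Phi \<phi> (\<integral>\<omega>. V k \<omega> \<partial>M)"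
    by (rule integral_suminf_le[OF d_integrable d_nonneg sum_expected_d_le])
  finally show "(\<integral>\<omega>. norm (x k \<omega> - xlim \<omega>) \<partial>M)
      \<le> sqrt c3 / (c1 * c2) * Phi \<phi> (\<integral>\<omega>. V k \<omega> \<partial>M)" .
qed

lemma converges_in_L1_xlim: "converges_in_L1 M x xlim"
proof -
  have "integrable M (x 0)"
    by (rule iffD2[OF Bochner_Integration.integrable_cong[OF refl deterministic_start]]) auto
  from Bochner_Integration.integrable_diff[OF this dist_xlim_integrable[of 0]]
  have xlim: "integrable M xlim"
    by simp
  have "integrable M (x k)" for k
    using Bochner_Integration.integrable_add[OF dist_xlim_integrable[of k] xlim] by simp
  moreover have "(\<lambda>k. \<integral>\<omega>. norm (x k \<omega> - xlim \<omega>) \<partial>M) \<longlonglongrightarrow> 0"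
  proof (rule tendsto_sandwich[OF _ _ tendsto_const])
    have "(\<lambda>k. Phi \<phi> (\<integral>\<omega>. V k \<omega> \<partial>M)) \<longlonglongrightarrow> 0"
      by (rule Phi_tendsto_0[OF expected_V_tendsto_0 expected_V_domain])
    then show "(\<lambda>k. sqrt c3 / (c1 * c2) * Phi \<phi> (\<integral>\<omega>. V k \<omega> \<partial>M)) \<longlonglongrightarrow> 0"
      by (rule tendsto_mult_right_zero)
    show "\<forall>\<^sub>F k in sequentially. (\<integral>\<omega>. norm (x k \<omega> - xlim \<omega>) \<partial>M)
        \<le> sqrt c3 / (c1 * c2) * Phi \<phi> (\<integral>\<omega>. V k \<omega> \<partial>M)"
      by (intro always_eventually allI expected_dist_xlim_le)
  qed (simp add: integral_nonneg_AE)
  ultimately show ?thesis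
    using xlim by (simp add: converges_in_L1_def)
qed

lemma AE_xlim_is_arg_min: "AE \<omega> in M. is_arg_min h (\<lambda>y. y \<in> S) (xlim \<omega>)"
  using AE_tendsto_xlim AE_V_tendsto_0 AE_space
proof eventually_elim
  case (elim \<omega>)
  have S: "xlim \<omega> \<in> S"
    using closed_sequentially[OF closed_S _ elim(1)] in_S[OF elim(3)] by blast
  have "(\<lambda>k. h (x k \<omega>)) \<longlonglongrightarrow> h (xlim \<omega>)"
    using continuous_on_tendsto_compose[OF continuous_h elim(1) S] in_S[OF elim(3)] by simp
  moreover have "(\<lambda>k. h (x k \<omega>)) \<longlonglongrightarrow> (INF z\<in>S. h z)"
    using elim(2) unfolding V_def by (simp add: LIM_zero_iff)
  ultimately have "h (xlim \<omega>) = (INF z\<in>S. h z)"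
    by (rule LIMSEQ_unique)
  then show ?case
    using S cINF_lower[OF h_bdd_below] by (auto simp: is_arg_min_def not_less)
qed

text \<open>Along the path \<open>d i\<close> is dominated by a geometric mean of a decrement of \<open>Phi (V i)\<close> and a
  decrement of \<open>Phi (rate i)\<close>. Both telescope to at most \<open>Phi (rate k)\<close>, so that AM-GM loses
  nothing against Cauchy-Schwarz.\<close>

lemma dist_xlim_le_Phi_rate:
  assumes \<omega>: "\<omega> \<in> space M" and summ: "summable (\<lambda>i. d i \<omega>)"
    and V_le: "\<And>i. k \<le> i \<Longrightarrow> V i \<omega> \<le> rate (Suc i)"
  shows "norm (x k \<omega> - xlim \<omega>) \<le> sqrt 2 / (c1 * sqrt c2) * Phi \<phi> (rate k)"
proof -
  let ?C = "sqrt 2 / (c1 * sqrt c2)"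
  define P where "P i = Phi \<phi> (V i \<omega>) - Phi \<phi> (V (Suc i) \<omega>)" for i
  define Q where "Q i = Phi \<phi> (rate i) - Phi \<phi> (rate (Suc i))" for i
  have P0: "0 \<le> P i" for i
    using Phi_V_Suc_le[OF \<omega>] by (simp add: P_def)
  have Q0: "0 \<le> Q i" for i
    using Phi_mono[OF less_imp_le[OF rate_pos] rate_Suc_le rate_less_\<tau>] by (simp add: Q_def)
  have C: "0 < ?C" "?C\<^sup>2 = 2 / (c1\<^sup>2 * c2)"
    using c1_pos c2_pos by (auto simp: power_divide power_mult_distrib)
  have d_le: "d i \<omega> \<le> ?C * ((P i + Q i) / 2)" if i: "k \<le> i" for i
  proof -
    let ?r = "\<phi> (rate (Suc i))"
    have r: "0 < ?r"
      by (rule \<phi>_gt_0[OF rate_pos rate_less_\<tau>])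
    \<comment> \<open>Here the one-step gain enters: \<open>rate (Suc i)\<close> is the left end
      point of the interval on which \<open>psi\<close> and \<open>Phi\<close> are compared below,
      so \<open>V i\<close> has to lie below it and not merely below \<open>rate i\<close>.\<close>
    have "\<phi> (V i \<omega>) \<le> ?r"
      by (rule \<phi>_le[OF V_nonneg[OF \<omega>] V_le[OF i] rate_less_\<tau>])
    then have "(d i \<omega>)\<^sup>2 / sqrt ?r \<le> \<alpha> i / c1 * P i"
      unfolding P_def by (rule weighted_d_sq_le_Phi_diff[OF \<omega>])
    then have d: "(d i \<omega>)\<^sup>2 \<le> \<alpha> i / c1 * P i * sqrt ?r"
      using r by (simp add: pos_divide_le_eq)
    have "c1 * c2 / 2 * \<alpha> i = psi (rate (Suc i)) - psi (rate i)"
      by (simp add: psi_rate A_Suc distrib_left add_divide_distrib)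
    then have "sqrt ?r * (c1 * c2 / 2 * \<alpha> i) \<le> Q i"
      using psi_diff_le_Phi_diff[OF rate_pos rate_Suc_le rate_less_\<tau>, of i] by (simp only: Q_def)
    then have "P i * (sqrt ?r * (c1 * c2 / 2 * \<alpha> i)) \<le> P i * Q i"
      using P0 by (rule mult_left_mono)
    \<comment> \<open>The multiplier turns \<open>c1 * c2 / 2\<close> into \<open>1 / c1\<close>,
      matching the bound on the squared step; its square root is the constant
      \<open>?C\<close>.\<close>
    then have "2 / (c1\<^sup>2 * c2) * (P i * (sqrt ?r * (c1 * c2 / 2 * \<alpha> i))) \<le> 2 / (c1\<^sup>2 * c2) * (P i * Q i)"
      by (rule mult_left_mono) (use c2_pos in simp)
    also have "2 / (c1\<^sup>2 * c2) * (P i * (sqrt ?r * (c1 * c2 / 2 * \<alpha> i))) = \<alpha> i / c1 * P i * sqrt ?r"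
      using c1_pos c2_pos by (simp add: power2_eq_square)
    finally have "(d i \<omega>)\<^sup>2 \<le> ?C\<^sup>2 * (P i * Q i)"
      using d C(2) by simp
    then have "sqrt ((d i \<omega>)\<^sup>2) \<le> sqrt (?C\<^sup>2 * (P i * Q i))"
      by (rule real_sqrt_le_mono)
    then have "d i \<omega> \<le> ?C * sqrt (P i * Q i)"
      using c1_pos c2_pos d_nonneg by (simp add: real_sqrt_mult[of "?C\<^sup>2"] abs_mult)
    also have "\<dots> \<le> ?C * ((P i + Q i) / 2)"
      using C(1) by (intro mult_left_mono arith_geo_mean_sqrt P0 Q0) simp
    finally show ?thesis .
  qed
  have "(\<Sum>i<n. d (k + i) \<omega>) \<le> ?C * Phi \<phi> (rate k)" for n
  proof -
    have "(\<Sum>i<n. d (k + i) \<omega>) \<le> (\<Sum>i<n. ?C * ((P (k + i) + Q (k + i)) / 2))"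
      by (intro sum_mono d_le) simp
    also have "\<dots> = ?C * (((\<Sum>i<n. P (k + i)) + (\<Sum>i<n. Q (k + i))) / 2)"
      by (simp only: sum.distrib flip: sum_distrib_left sum_divide_distrib)
    also have "\<dots> \<le> ?C * Phi \<phi> (rate k)"
    proof (rule mult_left_mono)
      have "(\<Sum>i<n. P (k + i)) = Phi \<phi> (V k \<omega>) - Phi \<phi> (V (k + n) \<omega>)"
        using sum_lessThan_telescope'[of "\<lambda>i. Phi \<phi> (V (k + i) \<omega>)" n] by (simp add: P_def)
      also have "\<dots> \<le> Phi \<phi> (rate k)"
      proof -
        have "V k \<omega> \<le> rate k"
          using V_le[of k] rate_Suc_le[of k] by simp
        then have "Phi \<phi> (V k \<omega>) \<le> Phi \<phi> (rate k)"
          by (intro Phi_mono V_nonneg[OF \<omega>] rate_less_\<tau>)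
        then show ?thesis
          using Phi_V_nonneg[OF \<omega>, of "k + n"] by simp
      qed
      finally have "(\<Sum>i<n. P (k + i)) \<le> Phi \<phi> (rate k)" .
      moreover have "(\<Sum>i<n. Q (k + i)) = Phi \<phi> (rate k) - Phi \<phi> (rate (k + n))"
        using sum_lessThan_telescope'[of "\<lambda>i. Phi \<phi> (rate (k + i))" n] by (simp add: Q_def)
      moreover have "0 \<le> Phi \<phi> (rate (k + n))"
        by (rule Phi_nonneg[OF less_imp_le[OF rate_pos] rate_less_\<tau>])
      ultimately show "((\<Sum>i<n. P (k + i)) + (\<Sum>i<n. Q (k + i))) / 2 \<le> Phi \<phi> (rate k)"
        by simp
    qed (use C in simp)
    finally show ?thesis .
  qed
  moreover have "summable (\<lambda>i. d (k + i) \<omega>)"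
    using summable_ignore_initial_segment[OF summ, of k] by (simp add: add.commute)
  ultimately have "(\<Sum>i. d (k + i) \<omega>) \<le> ?C * Phi \<phi> (rate k)"
    by (intro suminf_le_const)
  then show ?thesis
    using dist_xlim_le[OF summ, of k] by linarith
qed

end

theorem theorem6:
  fixes M :: "'a measure" and F :: "nat \<Rightarrow> 'a measure"
    and x :: "nat \<Rightarrow> 'a \<Rightarrow> real ^ 'd" and x0 :: "real ^ 'd"
    and S :: "(real ^ 'd) set" and g h :: "real ^ 'd \<Rightarrow> real"
    and c1 c2 c3 abar t0 hstar :: real and \<alpha> A :: "nat \<Rightarrow> real"
    and \<tau> :: ereal and \<phi> :: "real \<Rightarrow> real"
  defines "hstar \<equiv> (INF y\<in>S. h y)"
    and "A \<equiv> (\<lambda>k. \<Sum>i<k. \<alpha> i)"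
  assumes mra: "monotone_randomized_algorithm M F x x0 S g h c1 c2 c3 \<alpha>"
    and step: "stepsize_condition \<alpha> abar"
    and gueb: "global_unified_error_bound S g h \<tau> \<phi>"
    and t0: "0 < t0" "ereal t0 < \<tau>"
    and not_integrable: "\<not> integrable_near_0 \<tau> (\<lambda>s. 1 / \<phi> s)"
  shows
    "(\<forall>k\<ge>1. (\<integral>\<omega>. (h (x k \<omega>) - hstar) \<partial>M)
        \<le> exp (- ((1 - ln 2) / 2) * (c2 / (c3 * abar)) * A k) * (h x0 - hstar)
          + Psi_inv \<tau> \<phi> t0 (Psi \<phi> t0 (h x0 - hstar) + ereal (c1 * c2 / 2 * A k)))
     \<and> (\<exists>K2 :: 'a \<Rightarrow> enat. K2 \<in> M \<rightarrow>\<^sub>M count_space UNIV \<and> (AE \<omega> in M. K2 \<omega> < \<infinity>) \<and>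
          (AE \<omega> in M. \<forall>k. K2 \<omega> \<le> enat k \<longrightarrow>
             h (x k \<omega>) - hstar \<le> Psi_inv \<tau> \<phi> t0 (ereal (c1 * c2 / 2 * A k))))
     \<and> (integrable_near_0 \<tau> (\<lambda>s. 1 / sqrt (\<phi> s)) \<longrightarrow>
        (\<exists>xstar \<in> borel_measurable M.
           (AE \<omega> in M. (\<lambda>k. x k \<omega>) \<longlonglongrightarrow> xstar \<omega>) \<and>
           converges_in_L1 M x xstar \<and>
           (AE \<omega> in M. is_arg_min h (\<lambda>y. y \<in> S) (xstar \<omega>)) \<and>
           (\<forall>k. (\<integral>\<omega>. norm (x k \<omega> - xstar \<omega>) \<partial>M)
              \<le> sqrt c3 / (c1 * c2) * Phi \<phi> (\<integral>\<omega>. (h (x k \<omega>) - hstar) \<partial>M)) \<and>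
           (\<exists>K3 :: 'a \<Rightarrow> enat. K3 \<in> M \<rightarrow>\<^sub>M count_space UNIV \<and> (AE \<omega> in M. K3 \<omega> < \<infinity>) \<and>
              (AE \<omega> in M. \<forall>k. K3 \<omega> \<le> enat k \<longrightarrow>
                 norm (x k \<omega> - xstar \<omega>)
                   \<le> sqrt 2 / (c1 * sqrt c2)
                       * Phi \<phi> (Psi_inv \<tau> \<phi> t0 (ereal (c1 * c2 / 2 * A k)))))))"
proof -
  interpret mra: mra_error_bound M F x x0 S g h c1 c2 c3 \<alpha> \<tau> \<phi> t0 abar
    using mra step gueb t0 not_integrable
    by (intro mra_error_bound.intro error_bound_modulus.intro mra_error_bound_axioms.intro)
      (auto simp: global_unified_error_bound_def)
  have V: "h (x k \<omega>) - hstar = mra.V k \<omega>" for k \<omega>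
    by (simp add: mra.V_def hstar_def)
  have V0: "h x0 - hstar = mra.V0"
    by (simp add: mra.V0_def hstar_def)
  have A: "A k = mra.A k" for k
    by (simp add: mra.A_def A_def)
  have rate: "Psi_inv \<tau> \<phi> t0 (ereal (c1 * c2 / 2 * A k)) = mra.rate k" for k
    by (simp add: mra.rate_def A)
  \<comment> \<open>One index serves both almost sure bounds, because the distance bound rests on
    the gap bound with its one-step gain.\<close>
  obtain K where K: "K \<in> M \<rightarrow>\<^sub>M count_space UNIV" "AE \<omega> in M. K \<omega> < \<infinity>"
    and K_le: "\<And>\<omega> k. K \<omega> \<le> enat k \<Longrightarrow> mra.V k \<omega> \<le> mra.rate (Suc k)"
    by (rule AE_eventually_imp_random_index[OF _ mra.AE_eventually_V_le_rate]) measurable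
  show ?thesis
  proof (intro conjI allI impI)
    show "(\<integral>\<omega>. (h (x k \<omega>) - hstar) \<partial>M)
        \<le> exp (- ((1 - ln 2) / 2) * (c2 / (c3 * abar)) * A k) * (h x0 - hstar)
          + Psi_inv \<tau> \<phi> t0 (Psi \<phi> t0 (h x0 - hstar) + ereal (c1 * c2 / 2 * A k))" for k
      unfolding V V0 A by (rule mra.expected_V_le)
    show "\<exists>K2 :: 'a \<Rightarrow> enat. K2 \<in> M \<rightarrow>\<^sub>M count_space UNIV \<and> (AE \<omega> in M. K2 \<omega> < \<infinity>) \<and>
          (AE \<omega> in M. \<forall>k. K2 \<omega> \<le> enat k \<longrightarrow>
             h (x k \<omega>) - hstar \<le> Psi_inv \<tau> \<phi> t0 (ereal (c1 * c2 / 2 * A k)))"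
    proof (intro exI[of _ K] conjI K)
      have "h (x k \<omega>) - hstar \<le> Psi_inv \<tau> \<phi> t0 (ereal (c1 * c2 / 2 * A k))"
        if "K \<omega> \<le> enat k" for k \<omega>
        unfolding V rate by (rule order_trans[OF K_le[OF that] mra.rate_Suc_le])
      then show "AE \<omega> in M. \<forall>k. K \<omega> \<le> enat k \<longrightarrow>
          h (x k \<omega>) - hstar \<le> Psi_inv \<tau> \<phi> t0 (ereal (c1 * c2 / 2 * A k))"
        by simp
    qed
  next
    assume "integrable_near_0 \<tau> (\<lambda>s. 1 / sqrt (\<phi> s))"
    then interpret sq: mra_sqrt_error_bound M F x x0 S g h c1 c2 c3 \<alpha> \<tau> \<phi> t0 abar
      by unfold_locales
    show "\<exists>xstar \<in> borel_measurable M.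
           (AE \<omega> in M. (\<lambda>k. x k \<omega>) \<longlonglongrightarrow> xstar \<omega>) \<and>
           converges_in_L1 M x xstar \<and>
           (AE \<omega> in M. is_arg_min h (\<lambda>y. y \<in> S) (xstar \<omega>)) \<and>
           (\<forall>k. (\<integral>\<omega>. norm (x k \<omega> - xstar \<omega>) \<partial>M)
              \<le> sqrt c3 / (c1 * c2) * Phi \<phi> (\<integral>\<omega>. (h (x k \<omega>) - hstar) \<partial>M)) \<and>
           (\<exists>K3 :: 'a \<Rightarrow> enat. K3 \<in> M \<rightarrow>\<^sub>M count_space UNIV \<and> (AE \<omega> in M. K3 \<omega> < \<infinity>) \<and>
              (AE \<omega> in M. \<forall>k. K3 \<omega> \<le> enat k \<longrightarrow>
                 norm (x k \<omega> - xstar \<omega>)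
                   \<le> sqrt 2 / (c1 * sqrt c2)
                       * Phi \<phi> (Psi_inv \<tau> \<phi> t0 (ereal (c1 * c2 / 2 * A k)))))"
      unfolding V rate
    proof (intro bexI[of _ sq.xlim] exI[of _ K] conjI allI sq.AE_tendsto_xlim
        sq.converges_in_L1_xlim sq.AE_xlim_is_arg_min sq.expected_dist_xlim_le K sq.xlim_measurable)
      show "AE \<omega> in M. \<forall>k. K \<omega> \<le> enat k \<longrightarrow>
          norm (x k \<omega> - sq.xlim \<omega>) \<le> sqrt 2 / (c1 * sqrt c2) * Phi \<phi> (mra.rate k)"
        using sq.AE_summable_d AE_space
      proof eventually_elim
        case (elim \<omega>)
        show ?case
        proof (intro allI impI sq.dist_xlim_le_Phi_rate elim K_le)
          fix k i
          assume "K \<omega> \<le> enat k" "k \<le> i"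
          then show "K \<omega> \<le> enat i"
            by (meson enat_ord_simps(1) order_trans)
        qed
      qed
    qed
  qed
qed

end
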